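(* Let $T$ be any triangulation of the Klein bottle, and let $n_0^T, n_1^T, n_2^T$ be respectively the numbers of vertices, edges and triangles of $T$. Then $$n_0^T - n_1^T + n_2^T = 0.$$
   Context: A triangulation of a compact surface is a finite two-dimensional simplicial complex together with a homeomorphism from its geometric realization onto the surface. The Klein bottle is the surface obtained from a square by identifying one pair of opposite sides with parallel orientations and the other pair of opposite sides with reversed orientations. *)

theory Defs
  imports "HOL-Analysis.Analysis"
begin

text \<open>The points of the quotient space are the equivalence classes, and the topology is the
  finest one for which the class map is continuous.\<close>

definition quotient_topology :: "'a topology \<Rightarrow> ('a \<times> 'a) set \<Rightarrow> 'a set topology" where
  "quotient_topology X r =
     topology (\<lambda>U. U \<subseteq> topspace X // r \<and> openin X {x \<in> topspace X. r `` {x} \<in> U})"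

lemma openin_quotient_topology:
  "openin (quotient_topology X r) U \<longleftrightarrow>
     U \<subseteq> topspace X // r \<and> openin X {x \<in> topspace X. r `` {x} \<in> U}"
proof -
  have "istopology (\<lambda>U. U \<subseteq> topspace X // r \<and> openin X {x \<in> topspace X. r `` {x} \<in> U})"
    unfolding istopology_def
  proof (intro conjI allI impI; (elim conjE)?)
    fix S T
    assume "openin X {x \<in> topspace X. r `` {x} \<in> S}" "openin X {x \<in> topspace X. r `` {x} \<in> T}"
    then have "openin X ({x \<in> topspace X. r `` {x} \<in> S} \<inter> {x \<in> topspace X. r `` {x} \<in> T})"
      by (rule openin_Int)
    moreover have "{x \<in> topspace X. r `` {x} \<in> S} \<inter> {x \<in> topspace X. r `` {x} \<in> T}
        = {x \<in> topspace X. r `` {x} \<in> S \<inter> T}" by blast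
    ultimately show "openin X {x \<in> topspace X. r `` {x} \<in> S \<inter> T}" by simp
  next
    fix \<K>
    assume K: "\<forall>K\<in>\<K>. K \<subseteq> topspace X // r \<and> openin X {x \<in> topspace X. r `` {x} \<in> K}"
    have "openin X (\<Union>K\<in>\<K>. {x \<in> topspace X. r `` {x} \<in> K})"
      using K by blast
    moreover have "(\<Union>K\<in>\<K>. {x \<in> topspace X. r `` {x} \<in> K})
        = {x \<in> topspace X. r `` {x} \<in> \<Union>\<K>}" by blast
    ultimately show "openin X {x \<in> topspace X. r `` {x} \<in> \<Union>\<K>}" by simp
  qed blast+
  then show ?thesis
    by (simp add: quotient_topology_def topology_inverse')
qed

lemma topspace_quotient_topology: "topspace (quotient_topology X r) = topspace X // r"
proof
  show "topspace (quotient_topology X r) \<subseteq> topspace X // r"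
    using openin_quotient_topology openin_topspace by blast
  have "{x \<in> topspace X. r `` {x} \<in> topspace X // r} = topspace X"
    by (auto intro: quotientI)
  then have "openin (quotient_topology X r) (topspace X // r)"
    by (simp add: openin_quotient_topology)
  then show "topspace X // r \<subseteq> topspace (quotient_topology X r)"
    by (rule openin_subset)
qed

lemma quotient_map_quotient_topology:
  "quotient_map X (quotient_topology X r) (\<lambda>x. r `` {x})"
  unfolding quotient_map_def
  by (auto simp: topspace_quotient_topology openin_quotient_topology quotient_def)

definition unit_square :: "(real \<times> real) set" where
  "unit_square = {0..1} \<times> {0..1}"

text \<open>The vertical sides are glued in parallel, the horizontal sides with a reversal.\<close>

definition klein_glue :: "((real \<times> real) \<times> (real \<times> real)) set" where
  "klein_glue =
     {((0, t), (1, t)) | t. t \<in> {0..1}} \<union> {((t, 0), (1 - t, 1)) | t. t \<in> {0..1}}"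

text \<open>This is an equivalence relation on the whole plane, trivial outside the square; the class of
  a point of the square is contained in the square.\<close>

definition klein_rel :: "((real \<times> real) \<times> (real \<times> real)) set" where
  "klein_rel = (klein_glue \<union> klein_glue\<inverse>)\<^sup>*"

lemma equiv_klein_rel: "equiv UNIV klein_rel"
  unfolding klein_rel_def
  by (intro equivI refl_rtrancl trans_rtrancl sym_rtrancl sym_Un_converse) auto

lemma klein_rel_unit_square:
  assumes "(p, q) \<in> klein_rel" "p \<in> unit_square"
  shows "q \<in> unit_square"
  using assms unfolding klein_rel_def
  by (induction rule: rtrancl_induct) (auto simp: klein_glue_def unit_square_def)

definition klein_bottle :: "(real \<times> real) set topology" where
  "klein_bottle = quotient_topology (top_of_set unit_square) klein_rel"

text \<open>Simplicial complexes are finite geometric ones in a Euclidean space, so the geometric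
  realization of \<open>K\<close> is the union of its simplices. They contain the empty face,
  which is the simplex of dimension \<open>-1\<close>.\<close>

definition two_dim_simplicial_complex :: "'a::euclidean_space set set \<Rightarrow> bool" where
  "two_dim_simplicial_complex K \<longleftrightarrow>
     simplicial_complex K \<and> (\<forall>S\<in>K. aff_dim S \<le> 2) \<and> (\<exists>S\<in>K. aff_dim S = 2)"

definition is_triangulation_of ::
    "'a::euclidean_space set set \<Rightarrow> ('a \<Rightarrow> 'b) \<Rightarrow> 'b topology \<Rightarrow> bool" where
  "is_triangulation_of K h X \<longleftrightarrow>
     two_dim_simplicial_complex K \<and> homeomorphic_map (top_of_set (\<Union>K)) X h"

definition num_simplices :: "int \<Rightarrow> 'a::euclidean_space set set \<Rightarrow> nat" where
  "num_simplices d K = card {S \<in> K. d simplex S}"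

end

theory Submission
  imports Defs "HOL-Library.Z2" "HOL-Library.Function_Algebras"
begin

text \<open>
  Cohomology with coefficients in the field with two elements, computed by hand. The Klein bottle is
  the quotient of the plane by the group of the maps
  \<open>(x, y) \<mapsto> ((-1)^n x + m, y + n)\<close>, so a triangulation gives a covering \<open>p\<close> of its
  realization \<open>X\<close> by the plane. Invariance of domain shows that every edge lies in exactly two
  triangles, and \<open>X\<close> minus the vertices is connected, being the image of the plane minus a
  countable set; hence the coboundaries of 1-cochains are exactly the 2-cochains of even weight.
  A 1-cocycle, seen as a double covering of \<open>X\<close> trivialised over the open stars, becomes trivial on the
  plane, and is classified up to coboundaries by the homomorphism from the deck group
  that measures how the trivialisation changes. There are four such homomorphisms. Counting cochains,
  \<open>2^n\<^sub>1 = |Z\<^sup>1| |im d\<^sup>1|\<close>, \<open>|Z\<^sup>1| = 4 |B\<^sup>1|\<close>, \<open>2 |B\<^sup>1| = 2^n\<^sub>0\<close> and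
  \<open>2 |im d\<^sup>1| = 2^n\<^sub>2\<close>, which gives \<open>n\<^sub>1 = n\<^sub>0 + n\<^sub>2\<close>.
\<close>

section \<open>Counting over the field with two elements\<close>

text \<open>Only a homeomorphism relates the complex to the square, so edges may become wild curves
  in the Klein bottle, and there need be no common refinement with a standard triangulation.
  Combinatorics and topology therefore meet only in open stars: through functions that are locally
  constant there, Lebesgue numbers, and segments inside a single simplex. Two-element coefficients
  dispense with orientations, which this surface could not supply consistently. The number four
  comes from two free values on the generators \<open>deck 1 0\<close> and \<open>deck 0 1\<close>:
  the relation of the group says that the second conjugates the first to its inverse, and this is
  vacuous modulo two. Counting finite sets of functions replaces quotient spaces and their
  dimensions: the Betti numbers 1, 2, 1 over the field with two elements appear as the factors 2, 4,
  2.\<close>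

lemma card_eq_card_kernel_times_card_image:
  fixes f :: "'g::ab_group_add \<Rightarrow> 'h::ab_group_add"
  assumes "finite G" and zero: "0 \<in> G" and diff: "\<And>x y. x \<in> G \<Longrightarrow> y \<in> G \<Longrightarrow> x - y \<in> G"
    and hom: "\<And>x y. x \<in> G \<Longrightarrow> y \<in> G \<Longrightarrow> f (x - y) = f x - f y"
  shows "card G = card {x \<in> G. f x = 0} * card (f ` G)"
proof -
  have add: "x + y \<in> G" if "x \<in> G" "y \<in> G" for x y
    using diff[OF that(1) diff[OF zero that(2)]] by simp
  have "card {x \<in> G. f x = f z} = card {x \<in> G. f x = 0}" if "z \<in> G" for z
  proof (rule bij_betw_same_card[of "\<lambda>x. x - z"], rule bij_betwI[where g = "\<lambda>x. x + z"])
    show "(\<lambda>x. x + z) \<in> {x \<in> G. f x = 0} \<rightarrow> {x \<in> G. f x = f z}"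
    proof
      fix x assume x: "x \<in> {x \<in> G. f x = 0}"
      then have "f ((x + z) - z) = f (x + z) - f z"
        using that add hom by blast
      with x show "x + z \<in> {x \<in> G. f x = f z}" using that add by auto
    qed
  qed (use that diff hom in auto)
  then have "(\<Sum>y\<in>f ` G. card {x \<in> G. f x = y}) = (\<Sum>y\<in>f ` G. card {x \<in> G. f x = 0})"
    by (intro sum.cong) auto
  moreover have "card G = (\<Sum>y\<in>f ` G. card {x \<in> G. f x = y})"
    using sum.image_gen[OF \<open>finite G\<close>, of "\<lambda>_. 1::nat" f] by simp
  ultimately show ?thesis by simp
qed

text \<open>Bits are used as elements of a field; these rules would turn sums and products into bit
  operations, out of reach of the laws of groups and rings.\<close>

declare add_bit_eq_xor [simp del] mult_bit_eq_and [simp del]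

lemma bit_add_self [simp]: "(a::bit) + a = 0" "(a::bit) + (a + b) = b"
  by (cases a; cases b; simp add: add_bit_eq_xor)+

lemma bit_add_eq_0_iff: "(a::bit) + b = 0 \<longleftrightarrow> a = b"
  by (cases a; cases b) (simp_all add: add_bit_eq_xor)

lemma UNIV_bit: "(UNIV :: bit set) = {0, 1}"
  by (auto intro: bit.exhaust)

lemma card_UNIV_bit: "card (UNIV :: bit set) = 2"
  unfolding UNIV_bit by simp

text \<open>The cochains on \<open>A\<close>. They are total functions, made unique by the value 0
  off \<open>A\<close>, so that equality of cochains is equality of functions.\<close>

definition supp_fun :: "'b set \<Rightarrow> ('b \<Rightarrow> bit) set" where
  "supp_fun A = {f. \<forall>x. x \<notin> A \<longrightarrow> f x = 0}"

lemma supp_fun_zero [simp]: "0 \<in> supp_fun A"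
  by (simp add: supp_fun_def)

lemma supp_fun_add: "f \<in> supp_fun A \<Longrightarrow> g \<in> supp_fun A \<Longrightarrow> f + g \<in> supp_fun A"
  by (simp add: supp_fun_def)

lemma fun_bit_minus_eq_plus [simp]: "(f::'b \<Rightarrow> bit) - g = f + g"
  by (rule ext) simp

lemma bij_betw_supp_fun: "bij_betw (\<lambda>f. {x. f x = 1}) (supp_fun A) (Pow A)"
proof (rule bij_betwI[where g = "\<lambda>S x. if x \<in> S then 1 else 0"])
  show "(\<lambda>f. {x. f x = 1}) \<in> supp_fun A \<rightarrow> Pow A"
    by (force simp: supp_fun_def)
qed (auto simp: supp_fun_def fun_eq_iff)

lemma finite_supp_fun [simp]: "finite A \<Longrightarrow> finite (supp_fun A)"
  using bij_betw_finite[OF bij_betw_supp_fun] by blast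

lemma card_supp_fun: "finite A \<Longrightarrow> card (supp_fun A) = 2 ^ card A"
  using bij_betw_same_card[OF bij_betw_supp_fun] by (metis card_Pow)

section \<open>Local cocycles on starlike sets\<close>

text \<open>The primitive at \<open>x\<close> sums \<open>\<tau>\<close> along a fine subdivision of the segment from \<open>z\<close> to \<open>x\<close>.\<close>

lemma local_cocycle_trivial_bounded:
  fixes z :: "'v::real_normed_vector" and \<tau> :: "'v \<Rightarrow> 'v \<Rightarrow> 'g::ab_group_add"
  assumes star: "\<And>x. x \<in> S \<Longrightarrow> closed_segment z x \<subseteq> S" and bdd: "\<And>x. x \<in> S \<Longrightarrow> norm (x - z) \<le> R"
    and "\<epsilon> > 0"
    and coc: "\<And>x y w. \<lbrakk>x \<in> S; y \<in> S; w \<in> S; dist x y < \<epsilon>; dist y w < \<epsilon>; dist x w < \<epsilon>\<rbrakk>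
                \<Longrightarrow> \<tau> x y + \<tau> y w = \<tau> x w"
  shows "\<exists>G. \<forall>x\<in>S. \<forall>y\<in>S. dist x y < \<epsilon> / 2 \<longrightarrow> G y - G x = \<tau> x y"
proof -
  \<comment> \<open>With this many pieces, consecutive points of a subdivided segment are less than
    \<open>\<epsilon> / 2\<close> apart.\<close>
  obtain n :: nat where "2 * R / \<epsilon> < n" using reals_Archimedean2 by blast
  define N where "N = Suc n"
  have N: "N > 0" "R / N < \<epsilon> / 2"
    using \<open>2 * R / \<epsilon> < n\<close> \<open>\<epsilon> > 0\<close> by (auto simp: N_def field_simps)
  define pt where "pt x i = z + (real i / real N) *\<^sub>R (x - z)" for x i
  have pt0: "pt x 0 = z" and ptN: "pt x N = x" for x
    using N by (auto simp: pt_def)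
  have ptS: "pt x i \<in> S" if "x \<in> S" "i \<le> N" for x i
  proof -
    have "pt x i = (1 - real i / N) *\<^sub>R z + (real i / N) *\<^sub>R x"
      by (simp add: pt_def algebra_simps)
    moreover have "0 \<le> real i / N" "real i / N \<le> 1" using that N by (auto simp: divide_simps)
    ultimately have "pt x i \<in> closed_segment z x"
      unfolding closed_segment_def by blast
    then show ?thesis using star that by blast
  qed
  have step: "dist (pt x i) (pt x (Suc i)) < \<epsilon> / 2" if "x \<in> S" for x i
  proof -
    have "pt x (Suc i) - pt x i = (1 / real N) *\<^sub>R (x - z)"
      by (simp add: pt_def add_divide_distrib algebra_simps)
    then have "dist (pt x i) (pt x (Suc i)) = norm (x - z) / N"
      by (simp add: dist_norm norm_minus_commute[of "pt x i"])
    also have "\<dots> \<le> R / N" using bdd[OF that] N by (simp add: divide_right_mono)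
    finally show ?thesis using N by linarith
  qed
  have para: "dist (pt x i) (pt y i) \<le> dist x y" if "i \<le> N" for x y i
  proof -
    have "pt x i - pt y i = (real i / N) *\<^sub>R (x - y)"
      by (simp add: pt_def algebra_simps)
    then have "dist (pt x i) (pt y i) = (real i / N) * dist x y"
      by (simp add: dist_norm)
    also have "\<dots> \<le> 1 * dist x y" using that N by (intro mult_right_mono) auto
    finally show ?thesis by simp
  qed
  define G where "G k x = (\<Sum>i<k. \<tau> (pt x i) (pt x (Suc i)))" for k x
  have "G k y - G k x = \<tau> (pt x k) (pt y k)" if "x \<in> S" "y \<in> S" "dist x y < \<epsilon> / 2" "k \<le> N" for x y k
    using \<open>k \<le> N\<close>
  proof (induction k)
    case 0
    have "z \<in> S" using star[OF \<open>x \<in> S\<close>] by auto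
    then have "\<tau> z z + \<tau> z z = \<tau> z z" using coc[of z z z] \<open>\<epsilon> > 0\<close> by simp
    then show ?case by (simp add: G_def pt0)
  next
    case (Suc k)
    let ?a = "pt x k" and ?b = "pt x (Suc k)" and ?c = "pt y k" and ?d = "pt y (Suc k)"
    have S: "?a \<in> S" "?b \<in> S" "?c \<in> S" "?d \<in> S" using ptS that Suc.prems by auto
    have d: "dist ?a ?b < \<epsilon> / 2" "dist ?c ?d < \<epsilon> / 2" "dist ?a ?c < \<epsilon> / 2" "dist ?b ?d < \<epsilon> / 2"
      using step that para[of k x y] para[of "Suc k" x y] Suc.prems by auto
    have ad: "dist ?a ?d < \<epsilon>" using dist_triangle[of ?a ?d ?b] d by simp
    \<comment> \<open>The small quadrilateral is cut along its diagonal from \<open>?a\<close> to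
      \<open>?d\<close>, which is shorter than \<epsilon>; this is why the conclusion asks for
      distance below \<open>\<epsilon> / 2\<close>.\<close>
    have "\<tau> ?a ?b + \<tau> ?b ?d = \<tau> ?a ?d" "\<tau> ?a ?c + \<tau> ?c ?d = \<tau> ?a ?d"
      using coc S d ad \<open>\<epsilon> > 0\<close> by auto
    moreover have "G k y - G k x = \<tau> ?a ?c" using Suc by simp
    ultimately show ?case by (simp add: G_def algebra_simps)
  qed
  from this[where k = N] show ?thesis
    by (intro exI[of _ "G N"]) (auto simp: ptN)
qed

text \<open>Balls around \<open>z\<close> cut \<open>S\<close> into bounded starlike pieces.
  Primitives normalised to vanish at \<open>z\<close> agree on common pieces, since their difference
  is locally constant along the segment from \<open>z\<close>; hence they glue.\<close>

lemma local_cocycle_trivial: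
  fixes z :: "'v::real_normed_vector" and \<tau> :: "'v \<Rightarrow> 'v \<Rightarrow> 'g::ab_group_add"
  assumes star: "\<And>x. x \<in> S \<Longrightarrow> closed_segment z x \<subseteq> S" and "\<epsilon> > 0"
    and coc: "\<And>x y w. \<lbrakk>x \<in> S; y \<in> S; w \<in> S; dist x y < \<epsilon>; dist y w < \<epsilon>; dist x w < \<epsilon>\<rbrakk>
                \<Longrightarrow> \<tau> x y + \<tau> y w = \<tau> x w"
  shows "\<exists>G. \<forall>x\<in>S. \<forall>y\<in>S. dist x y < \<epsilon> / 2 \<longrightarrow> G y - G x = \<tau> x y"
proof -
  define S' where "S' N = S \<inter> cball z (real N)" for N
  have star': "closed_segment z x \<subseteq> S' N" if "x \<in> S' N" for x N
  proof -
    have "closed_segment z x \<subseteq> cball z (real N)"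
      using that by (intro closed_segment_subset) (auto simp: S'_def)
    with star[of x] that show ?thesis by (auto simp: S'_def)
  qed
  have "\<exists>G. \<forall>x\<in>S' N. \<forall>y\<in>S' N. dist x y < \<epsilon> / 2 \<longrightarrow> G y - G x = \<tau> x y" for N
    by (rule local_cocycle_trivial_bounded[where R = N and z = z])
      (use star' coc \<open>\<epsilon> > 0\<close> in \<open>auto simp: S'_def dist_norm norm_minus_commute\<close>)
  then obtain G' where G': "\<And>N x y. \<lbrakk>x \<in> S' N; y \<in> S' N; dist x y < \<epsilon> / 2\<rbrakk> \<Longrightarrow> G' N y - G' N x = \<tau> x y"
    by metis
  define G where "G N x = G' N x - G' N z" for N x
  have G: "G N y - G N x = \<tau> x y" if "x \<in> S' N" "y \<in> S' N" "dist x y < \<epsilon> / 2" for N x y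
    using G'[OF that] by (simp add: G_def)
  have indep: "G N x = G M x" if x: "x \<in> S' N" and "N \<le> M" for N M x
  proof -
    have sub: "S' N \<subseteq> S' M" using \<open>N \<le> M\<close> by (auto simp: S'_def)
    have "G N z - G M z = G N x - G M x"
    proof (rule connected_local_const[where f = "\<lambda>x. G N x - G M x"])
      show "connected (closed_segment z x)" by simp
      show "\<forall>a\<in>closed_segment z x. \<forall>\<^sub>F b in at a within closed_segment z x. G N a - G M a = G N b - G M b"
      proof
        fix a assume a: "a \<in> closed_segment z x"
        have "\<forall>\<^sub>F b in at a within closed_segment z x. b \<in> closed_segment z x \<and> dist b a < \<epsilon> / 2"
          using \<open>\<epsilon> > 0\<close> unfolding eventually_at by (intro exI[of _ "\<epsilon>/2"]) auto
        then show "\<forall>\<^sub>F b in at a within closed_segment z x. G N a - G M a = G N b - G M b"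
        proof eventually_elim
          case (elim b)
          have "G N b - G N a = \<tau> a b" "G M b - G M a = \<tau> a b"
            using elim a star'[OF x] sub by (auto simp: dist_commute intro!: G)
          then show ?case by (metis add_diff_cancel_left diff_add_cancel)
        qed
      qed
    qed auto
    then show ?thesis by (simp add: G_def)
  qed
  define H where "H x = G (nat \<lceil>dist z x\<rceil>) x" for x
  have in_S': "x \<in> S' (nat \<lceil>dist z x\<rceil>)" if "x \<in> S" for x
    using that by (auto simp: S'_def)
  have "H y - H x = \<tau> x y" if "x \<in> S" "y \<in> S" "dist x y < \<epsilon> / 2" for x y
  proof -
    define M where "M = max (nat \<lceil>dist z x\<rceil>) (nat \<lceil>dist z y\<rceil>)"
    have "S' (nat \<lceil>dist z x\<rceil>) \<subseteq> S' M" "S' (nat \<lceil>dist z y\<rceil>) \<subseteq> S' M"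
      unfolding S'_def M_def by (intro Int_mono subset_cball order_refl; simp)+
    then have "x \<in> S' M" "y \<in> S' M" using in_S' that by auto
    then have "G M y - G M x = \<tau> x y" using G that by blast
    moreover have "H x = G M x" "H y = G M y"
      using indep in_S' that unfolding H_def M_def by auto
    ultimately show ?thesis by simp
  qed
  then show ?thesis by blast
qed

section \<open>Carriers in a simplicial complex\<close>

text \<open>\<open>K\<close> consists of the vertex sets of the simplices, not of the simplices, so
  faces are subsets and \<open>hull_Int\<close> states that simplices meet in the simplex on their
  common vertices. The word plane refers to the bound \<open>card_le_3\<close>; the ambient space
  may have any dimension.\<close>

locale plane_simplicial_complex =
  fixes K :: "'a::euclidean_space set set"
  assumes finite_K: "finite K"
    and subset_in_K: "C \<in> K \<Longrightarrow> D \<subseteq> C \<Longrightarrow> D \<in> K"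
    and indep: "C \<in> K \<Longrightarrow> \<not> affine_dependent C"
    and card_le_3: "C \<in> K \<Longrightarrow> card C \<le> 3"
    and hull_Int: "C \<in> K \<Longrightarrow> D \<in> K \<Longrightarrow> convex hull C \<inter> convex hull D = convex hull (C \<inter> D)"
begin

definition X :: "'a set" where "X = (\<Union>C\<in>K. convex hull C)"

text \<open>The carrier: the vertices of the smallest simplex containing \<open>x\<close>. For
  \<open>x\<close> in \<open>X\<close>, \<open>v \<in> car x\<close> says that \<open>x\<close> lies
  in the open star of \<open>v\<close>. Outside \<open>X\<close> the value is \<open>UNIV\<close>,
  so stars are always restricted to \<open>X\<close>.\<close>

definition car :: "'a \<Rightarrow> 'a set" where "car x = \<Inter>{C \<in> K. x \<in> convex hull C}"

definition V :: "'a set" where "V = {v. {v} \<in> K}"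
definition E :: "'a set set" where "E = {C \<in> K. card C = 2}"
definition F :: "'a set set" where "F = {C \<in> K. card C = 3}"

lemma finite_simplex: "C \<in> K \<Longrightarrow> finite C"
  using indep aff_independent_finite by blast

lemma in_X: "C \<in> K \<Longrightarrow> x \<in> convex hull C \<Longrightarrow> x \<in> X"
  by (auto simp: X_def)

lemma compact_hull: "C \<in> K \<Longrightarrow> compact (convex hull C)"
  by (simp add: finite_simplex finite_imp_compact_convex_hull)

lemma closed_hulls:
  assumes "\<C> \<subseteq> K"
  shows "closed (\<Union>C\<in>\<C>. convex hull C)"
proof (rule closed_UN)
  show "finite \<C>" using assms finite_K by (rule finite_subset)
  show "\<forall>C\<in>\<C>. closed (convex hull C)"
    using assms compact_hull compact_imp_closed by blast
qed

lemma compact_X: "compact X"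
  unfolding X_def using finite_K compact_hull by (rule compact_UN)

lemma finite_E: "finite E" and finite_F: "finite F"
  using finite_K by (auto simp: E_def F_def)

lemma V_eq: "V = \<Union>K"
proof
  show "\<Union>K \<subseteq> V" using subset_in_K[of _ "{_}"] by (auto simp: V_def)
qed (auto simp: V_def)

lemma finite_V: "finite V"
  using finite_K finite_simplex by (auto simp: V_eq)

lemma car_subset: "C \<in> K \<Longrightarrow> x \<in> convex hull C \<Longrightarrow> car x \<subseteq> C"
  by (auto simp: car_def)

text \<open>Only finitely many simplices contain \<open>x\<close>; by \<open>hull_Int\<close> and
  induction, their intersection is again one of them.\<close>

lemma car_in_K_hull:
  assumes "x \<in> X"
  shows "car x \<in> K" "x \<in> convex hull (car x)"
proof -
  have *: "\<Inter>\<C> \<in> K \<and> x \<in> convex hull (\<Inter>\<C>)"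
    if "finite \<C>" "\<C> \<noteq> {}" "\<C> \<subseteq> {C \<in> K. x \<in> convex hull C}" for \<C>
    using that
  proof (induction rule: finite_ne_induct)
    case (insert C \<C>)
    then have "C \<in> K" "x \<in> convex hull C" "\<Inter>\<C> \<in> K" "x \<in> convex hull (\<Inter>\<C>)"
      by auto
    then show ?case using hull_Int[of C "\<Inter>\<C>"] subset_in_K[of C "C \<inter> \<Inter>\<C>"] by auto
  qed auto
  have "{C \<in> K. x \<in> convex hull C} \<noteq> {}" using assms by (auto simp: X_def)
  then show "car x \<in> K" "x \<in> convex hull (car x)"
    using *[of "{C \<in> K. x \<in> convex hull C}"] finite_K by (auto simp: car_def)
qed

lemma car_nonempty: "x \<in> X \<Longrightarrow> car x \<noteq> {}"
  using car_in_K_hull(2)[of x] by (cases "car x = {}") auto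

lemma in_car_iff: "x \<in> X \<Longrightarrow> v \<in> car x \<longleftrightarrow> (\<forall>C\<in>K. x \<in> convex hull C \<longrightarrow> v \<in> C)"
  by (auto simp: car_def)

lemma in_hull_iff: "x \<in> X \<Longrightarrow> C \<in> K \<Longrightarrow> x \<in> convex hull C \<longleftrightarrow> car x \<subseteq> C"
  using car_subset[of C x] car_in_K_hull(2)[of x] hull_mono[of "car x" C convex] by auto

lemma car_vertex:
  assumes "v \<in> V"
  shows "v \<in> X" "car v = {v}"
proof -
  have K: "{v} \<in> K" using assms by (simp add: V_def)
  then show "v \<in> X" using in_X[of "{v}" v] by simp
  then show "car v = {v}" using car_nonempty car_subset[OF K, of v] by auto
qed

text \<open>Faces absorb segments: a face of a simplex that meets an open segment contains its ends.\<close>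

lemma car_open_segment:
  assumes C: "C \<in> K" "a \<in> convex hull C" "b \<in> convex hull C" and y: "y \<in> open_segment a b"
  shows "car y = car a \<union> car b"
proof
  have aX: "a \<in> X" and bX: "b \<in> X" using C in_X by auto
  have sub: "car a \<union> car b \<in> K" using C car_subset subset_in_K by (metis Un_least)
  have "y \<in> closed_segment a b" using y open_closed_segment by blast
  moreover have "closed_segment a b \<subseteq> convex hull (car a \<union> car b)"
    using car_in_K_hull(2) aX bX hull_mono[of _ "car a \<union> car b" convex]
    by (intro closed_segment_subset) auto
  ultimately have yh: "y \<in> convex hull (car a \<union> car b)" by blast
  then show "car y \<subseteq> car a \<union> car b" using sub car_subset by blast
  have yX: "y \<in> X" using yh sub in_X by blast
  show "car a \<union> car b \<subseteq> car y"
  proof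
    fix v assume v: "v \<in> car a \<union> car b"
    have "v \<in> D" if D: "D \<in> K" "y \<in> convex hull D" for D
    proof -
      have "y \<in> convex hull C"
        using yh C car_subset by (metis (no_types, opaque_lifting) Un_least hull_mono subsetD)
      then have "y \<in> convex hull (C \<inter> D)" using hull_Int C D by blast
      moreover have "convex hull (C \<inter> D) face_of convex hull C"
        using face_of_convex_hull_affine_independent[OF indep[OF C(1)]] by blast
      ultimately have "a \<in> convex hull (C \<inter> D)" "b \<in> convex hull (C \<inter> D)"
        using y C unfolding face_of_def by blast+
      then have "a \<in> convex hull D" "b \<in> convex hull D"
        using hull_mono[of "C \<inter> D" D convex] by auto
      then show ?thesis using v D car_subset by blast
    qed
    then show "v \<in> car y" using yX in_car_iff by blast
  qed
qed

text \<open>The open star of \<open>v\<close> meets every simplex in a convex set, which allows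
  arguments by continuity along segments.\<close>

lemma car_closed_segment:
  assumes "v \<in> car a" "v \<in> car b" "C \<in> K" "a \<in> convex hull C" "b \<in> convex hull C"
    "y \<in> closed_segment a b"
  shows "v \<in> car y"
proof (cases "y = a \<or> y = b")
  case False
  then have "y \<in> open_segment a b" using assms by (simp add: open_segment_def)
  then show ?thesis using car_open_segment assms by blast
qed (use assms in auto)

text \<open>Its complement in \<open>X\<close> is the union of the finitely many simplices without
  the vertex \<open>v\<close>.\<close>

lemma open_star: "openin (top_of_set X) {x \<in> X. v \<in> car x}"
proof -
  have "{x \<in> X. v \<in> car x} = X \<inter> - (\<Union>C\<in>{C \<in> K. v \<notin> C}. convex hull C)"
    by (auto simp: in_car_iff)
  moreover have "openin (top_of_set X) (X \<inter> - (\<Union>C\<in>{C \<in> K. v \<notin> C}. convex hull C))"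
    by (intro openin_open_Int open_Compl closed_hulls) auto
  ultimately show ?thesis by (simp only:)
qed

lemma edge_midpoint:
  assumes "{v, w} \<in> K"
  shows "midpoint v w \<in> X" "car (midpoint v w) = {v, w}" "midpoint v w \<in> convex hull {v, w}"
proof -
  have vw: "v \<in> V" "w \<in> V" using assms by (auto simp: V_eq)
  show h: "midpoint v w \<in> convex hull {v, w}"
    by (metis midpoint_in_closed_segment segment_convex_hull)
  then show "midpoint v w \<in> X" using assms in_X by blast
  show "car (midpoint v w) = {v, w}"
  proof (cases "v = w")
    case True then show ?thesis using car_vertex vw by auto
  next
    case False
    then have "midpoint v w \<in> open_segment v w" by simp
    moreover have "v \<in> convex hull {v, w}" "w \<in> convex hull {v, w}" by (auto intro: hull_inc)
    ultimately show ?thesis using car_open_segment[OF assms] car_vertex vw by auto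
  qed
qed

text \<open>A further vertex is absorbed by moving halfway towards it: carriers of the two ends of a
  segment unite at the midpoint.\<close>

lemma face_interior_point:
  assumes "C \<in> K" "C \<noteq> {}"
  obtains x where "x \<in> X" "car x = C"
proof -
  have "\<exists>x \<in> X. car x = D" if "finite D" "D \<noteq> {}" "D \<in> K" for D
    using that
  proof (induction rule: finite_ne_induct)
    case (singleton v)
    then show ?case using car_vertex[of v] by (auto simp: V_def)
  next
    case (insert v D)
    then obtain x where x: "x \<in> X" "car x = D"
      using subset_in_K[of "insert v D" D] by blast
    have v: "v \<in> V" using insert by (auto simp: V_eq)
    have h: "v \<in> convex hull (insert v D)" "x \<in> convex hull (insert v D)"
      using x car_in_K_hull(2)[OF x(1)] hull_mono[of D "insert v D" convex] by (auto intro: hull_inc)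
    have "v \<noteq> x" using x insert car_vertex[OF v] by auto
    then have m: "midpoint v x \<in> open_segment v x" by simp
    then have "midpoint v x \<in> convex hull (insert v D)"
      using h by (meson convex_contains_open_segment convex_convex_hull subsetD)
    then have "midpoint v x \<in> X" using insert in_X by blast
    moreover have "car (midpoint v x) = insert v D"
      using car_open_segment[OF _ h m] insert.prems car_vertex[OF v] x by auto
    ultimately show ?case by blast
  qed
  then show ?thesis using assms finite_simplex that by blast
qed

section \<open>Connectedness in terms of edges and triangles\<close>

lemma E_iff: "e \<in> E \<longleftrightarrow> (\<exists>v w. v \<noteq> w \<and> e = {v, w} \<and> {v, w} \<in> K)"
  by (auto simp: E_def card_2_iff)

text \<open>Closure under adjacency leaves every simplex with all its vertices in \<open>Y\<close>
  or none, so \<open>X\<close> splits into two disjoint closed subcomplexes.\<close>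

lemma V_connected:
  assumes "connected X" "Y \<subseteq> V" "Y \<noteq> {}"
    and closed_adj: "\<And>v w. v \<in> Y \<Longrightarrow> {v, w} \<in> K \<Longrightarrow> w \<in> Y"
  shows "Y = V"
proof (rule ccontr)
  assume "Y \<noteq> V"
  define P where "P = (\<Union>C\<in>{C \<in> K. C \<subseteq> Y}. convex hull C)"
  define Q where "Q = (\<Union>C\<in>{C \<in> K. C \<inter> Y = {}}. convex hull C)"
  have "closed P" "closed Q" unfolding P_def Q_def
    by (rule closed_hulls, simp)+
  moreover have "X \<subseteq> P \<union> Q"
  proof -
    have "C \<subseteq> Y \<or> C \<inter> Y = {}" if "C \<in> K" for C
    proof -
      have "w \<in> Y" if "v \<in> C" "v \<in> Y" "w \<in> C" for v w
        using that closed_adj[of v w] subset_in_K[OF \<open>C \<in> K\<close>, of "{v, w}"] by simp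
      then show ?thesis by auto
    qed
    then show ?thesis unfolding X_def P_def Q_def by blast
  qed
  moreover have "P \<inter> Q \<inter> X = {}"
  proof -
    have "car x \<subseteq> Y \<and> car x \<inter> Y = {}" if "x \<in> P" "x \<in> Q" for x
      using that car_subset unfolding P_def Q_def by blast
    then show ?thesis using car_nonempty by blast
  qed
  moreover have "P \<inter> X \<noteq> {}"
  proof -
    obtain v where "v \<in> Y" using assms by blast
    then have "v \<in> V" using assms by blast
    then have "v \<in> P" unfolding P_def using \<open>v \<in> Y\<close> by (intro UN_I[of "{v}"]) (auto simp: V_def)
    then show ?thesis using car_vertex \<open>v \<in> V\<close> by blast
  qed
  moreover have "Q \<inter> X \<noteq> {}"
  proof -
    obtain v where "v \<in> V" "v \<notin> Y" using assms \<open>Y \<noteq> V\<close> by blast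
    then have "v \<in> Q" unfolding Q_def by (intro UN_I[of "{v}"]) (auto simp: V_def)
    then show ?thesis using car_vertex \<open>v \<in> V\<close> by blast
  qed
  ultimately show False using connected_closedD[OF \<open>connected X\<close>, of P Q] by simp
qed

text \<open>Vertices are removed because two triangles may meet in just a vertex. Any other point
  has at least two vertices in its carrier, so triangles sharing it share an edge, and the triangles
  in \<open>Y\<close> and those outside separate \<open>X - V\<close>.\<close>

lemma F_connected:
  assumes conn: "connected (X - V)" and Y: "Y \<subseteq> F" "Y \<noteq> {}"
    and deg: "\<And>e. e \<in> E \<Longrightarrow> \<exists>t\<in>F. e \<subseteq> t"
    and closed_adj: "\<And>e t s. \<lbrakk>e \<in> E; t \<in> Y; s \<in> F; e \<subseteq> t; e \<subseteq> s\<rbrakk> \<Longrightarrow> s \<in> Y"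
  shows "Y = F"
proof (rule ccontr)
  assume "Y \<noteq> F"
  define P where "P = (\<Union>C\<in>Y. convex hull C)"
  define Q where "Q = (\<Union>C\<in>F - Y. convex hull C)"
  have FK: "F \<subseteq> K" by (auto simp: F_def)
  have "closed P" "closed Q" unfolding P_def Q_def
    using Y FK by (intro closed_hulls; blast)+
  have card_car: "card (car x) \<ge> 2" if "x \<in> X - V" for x
  proof (rule ccontr)
    assume "\<not> card (car x) \<ge> 2"
    moreover have "finite (car x)" "car x \<noteq> {}" "car x \<in> K"
      using that car_in_K_hull finite_simplex car_nonempty by auto
    ultimately have "card (car x) = 1" using card_gt_0_iff[of "car x"] by linarith
    then obtain v where "car x = {v}" by (rule card_1_singletonE)
    then show False using car_in_K_hull[of x] that by (auto simp: V_def)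
  qed
  have "X - V \<subseteq> P \<union> Q"
  proof
    fix x assume x: "x \<in> X - V"
    then obtain e where e: "e \<subseteq> car x" "card e = 2"
      using card_car obtain_subset_with_card_n by metis
    have cK: "car x \<in> K" "x \<in> convex hull (car x)" using x car_in_K_hull by auto
    have "\<exists>t\<in>F. car x \<subseteq> t"
    proof (cases "card (car x) = 2")
      case True
      then show ?thesis using deg cK by (auto simp: E_def)
    next
      case False
      then have "card (car x) = 3" using card_car[OF x] card_le_3[OF cK(1)] by linarith
      then show ?thesis using cK by (auto simp: F_def)
    qed
    then obtain t where "t \<in> F" "x \<in> convex hull t" using cK hull_mono by blast
    then show "x \<in> P \<union> Q" by (auto simp: P_def Q_def)
  qed
  moreover have "P \<inter> Q \<inter> (X - V) = {}"
  proof -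
    have False if x: "x \<in> P" "x \<in> Q" "x \<in> X - V" for x
    proof -
      obtain t s where ts: "t \<in> Y" "s \<in> F" "s \<notin> Y" "x \<in> convex hull t" "x \<in> convex hull s"
        using x by (auto simp: P_def Q_def)
      then have sub: "car x \<subseteq> t \<inter> s" using Y FK car_subset by blast
      obtain e where e: "e \<subseteq> car x" "card e = 2"
        using card_car[OF x(3)] obtain_subset_with_card_n by metis
      then have "e \<in> E" using sub ts FK subset_in_K[of s e] by (auto simp: E_def)
      then show False using closed_adj[of e t s] ts e sub by blast
    qed
    then show ?thesis by blast
  qed
  moreover have ne: "\<exists>x \<in> X - V. x \<in> convex hull t" if "t \<in> F" for t
  proof -
    have "t \<in> K" "t \<noteq> {}" using that by (auto simp: F_def)
    then obtain x where x: "x \<in> X" "car x = t" using face_interior_point by blast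
    then have "x \<notin> V" using that car_vertex by (force simp: F_def)
    then show ?thesis using x car_in_K_hull by blast
  qed
  have "P \<inter> (X - V) \<noteq> {}" "Q \<inter> (X - V) \<noteq> {}"
    using Y \<open>Y \<noteq> F\<close> ne unfolding P_def Q_def by blast+
  ultimately show False using connected_closedD[OF conn, of P Q] \<open>closed P\<close> \<open>closed Q\<close> by simp
qed

end

section \<open>Complexes covered by the plane\<close>

definition par :: "int \<Rightarrow> real" where "par n = (if even n then 1 else -1)"

text \<open>The deck transformations of the universal covering of the Klein bottle by the plane.\<close>

definition deck :: "int \<Rightarrow> int \<Rightarrow> real \<times> real \<Rightarrow> real \<times> real" where
  "deck m n q = (par n * fst q + of_int m, snd q + of_int n)"

lemma deck_0 [simp]: "deck 0 0 q = q"
  by (simp add: deck_def par_def)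

text \<open>The group law is that of a semidirect product of two copies of the integers, in which
  odd \<open>n\<close> inverts the first factor.\<close>

lemma deck_deck: "deck m n (deck m' n' q) = deck (m + (if even n then m' else - m')) (n + n') q"
  by (simp add: deck_def par_def)

lemma deck_inverse: "deck (if even n then - m else m) (- n) (deck m n q) = q"
  by (simp add: deck_deck)

lemma dist_deck: "dist (deck m n q) (deck m n q') = dist q q'"
  by (simp add: deck_def par_def dist_prod_def dist_real_def power2_commute)

text \<open>Second coordinates differ by an integer, and once these agree so do first coordinates.
  Hence the action is free with orbits of spacing at least 1, the source of the radii used
  below.\<close>

lemma deck_eq_if_close:
  assumes "dist (deck m n q) (deck m' n' q) < 1"
  shows "m = m'" "n = n'"
proof -
  have "\<bar>real_of_int n - of_int n'\<bar> < 1"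
    using le_less_trans[OF dist_snd_le assms] by (simp add: deck_def dist_real_def)
  then show n: "n = n'" by linarith
  have "\<bar>real_of_int m - of_int m'\<bar> < 1"
    using le_less_trans[OF dist_fst_le assms] n by (simp add: deck_def dist_real_def)
  then show "m = m'" by linarith
qed

section \<open>Affine coordinates around the midpoint of an edge\<close>

lemma triangle_normal:
  fixes v w u :: "'a::euclidean_space"
  assumes ind: "\<not> affine_dependent {v, w, u}" and "v \<noteq> w" "u \<noteq> v" "u \<noteq> w"
  obtains n where "(w - v) \<bullet> n = 0" "(u - midpoint v w) \<bullet> n > 0"
proof -
  define d where "d = w - v"
  define k where "k = ((u - midpoint v w) \<bullet> d) / (d \<bullet> d)"
  \<comment> \<open>One Gram-Schmidt step: the part of \<open>u - midpoint v w\<close> orthogonal to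
    the edge. It vanishes only if \<open>u\<close> lies on the line through \<open>v\<close> and
    \<open>w\<close>.\<close>
  define n where "n = (u - midpoint v w) - k *\<^sub>R d"
  have "d \<noteq> 0" using assms by (simp add: d_def)
  then have "k * (d \<bullet> d) = (u - midpoint v w) \<bullet> d" by (simp add: k_def)
  then have dn: "d \<bullet> n = 0"
    using inner_commute[of d "u - midpoint v w"] by (simp add: n_def inner_diff_right[of d])
  have "n \<noteq> 0"
  proof
    assume "n = 0"
    then have "u = midpoint v w + k *\<^sub>R d" by (simp add: n_def algebra_simps)
    also have "\<dots> = (1/2 - k) *\<^sub>R v + (1/2 + k) *\<^sub>R w"
      by (simp add: midpoint_def d_def algebra_simps)
    finally have "u \<in> affine hull {v, w}"
      unfolding affine_hull_2 by (intro CollectI exI[of _ "1/2 - k"] exI[of _ "1/2 + k"]) simp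
    moreover have "{v, w, u} - {u} = {v, w}" using assms by auto
    ultimately show False using ind unfolding affine_dependent_def by (metis insertI1 insertI2)
  qed
  have "(u - midpoint v w) \<bullet> n = (n + k *\<^sub>R d) \<bullet> n" by (simp add: n_def)
  also have "\<dots> = n \<bullet> n" using dn by (simp add: inner_add_left)
  finally have "(u - midpoint v w) \<bullet> n > 0" using \<open>n \<noteq> 0\<close> by simp
  with dn that show ?thesis by (simp add: d_def)
qed

lemma hull2_coords:
  fixes v w :: "'a::euclidean_space"
  assumes "x \<in> convex hull {v, w}"
  obtains s where "x = midpoint v w + s *\<^sub>R (w - v)"
proof -
  obtain b where x: "x = (1 - b) *\<^sub>R v + b *\<^sub>R w"
    using assms by (auto simp flip: segment_convex_hull simp: closed_segment_def)
  have "x = midpoint v w + (b - 1/2) *\<^sub>R (w - v)"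
    unfolding x midpoint_def by (simp add: algebra_simps flip: scaleR_add_left)
  then show ?thesis by (rule that)
qed

lemma hull3_coords:
  fixes v w u :: "'a::euclidean_space"
  assumes "x \<in> convex hull {v, w, u}"
  obtains s t where "t \<ge> 0" "x = midpoint v w + s *\<^sub>R (w - v) + t *\<^sub>R (u - midpoint v w)"
proof -
  obtain a b c where abc: "0 \<le> a" "0 \<le> b" "0 \<le> c" "a + b + c = 1" and x: "x = a *\<^sub>R v + b *\<^sub>R w + c *\<^sub>R u"
    using assms by (auto simp: convex_hull_3)
  have a: "a = 1 - b - c" using abc by simp
  have "x = midpoint v w + ((b - a) / 2) *\<^sub>R (w - v) + c *\<^sub>R (u - midpoint v w)"
    unfolding x midpoint_def a by (rule euclidean_eqI) (simp add: algebra_simps inner_simps divide_simps)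
  then show ?thesis using that abc by blast
qed

text \<open>The barycentric weights of \<open>v\<close> and \<open>w\<close> are
  \<open>1/2 - s - t/2\<close> and \<open>1/2 + s - t/2\<close>; the second hypothesis makes both
  nonnegative.\<close>

lemma hull3_coords_converse:
  fixes v w u :: "'a::euclidean_space"
  assumes "t \<ge> 0" "2 * \<bar>s\<bar> + t \<le> 1"
  shows "midpoint v w + s *\<^sub>R (w - v) + t *\<^sub>R (u - midpoint v w) \<in> convex hull {v, w, u}"
proof -
  have "midpoint v w + s *\<^sub>R (w - v) + t *\<^sub>R (u - midpoint v w)
      = (1/2 - s - t/2) *\<^sub>R v + (1/2 + s - t/2) *\<^sub>R w + t *\<^sub>R u"
    unfolding midpoint_def by (rule euclidean_eqI) (simp add: algebra_simps inner_simps divide_simps)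
  moreover have "1/2 - s - t/2 \<ge> 0" "1/2 + s - t/2 \<ge> 0" using assms by auto
  ultimately show ?thesis unfolding convex_hull_3
    using assms(1) by (intro CollectI exI[of _ "1/2 - s - t/2"] exI[of _ "1/2 + s - t/2"] exI[of _ t]) auto
qed

text \<open>The Klein bottle enters the combinatorial argument only here, as the orbit space of the
  deck transformations. That \<open>p\<close> is a covering follows from openness and the spacing of
  the orbits.\<close>

locale klein_cover = plane_simplicial_complex K for K :: "'a::euclidean_space set set" +
  fixes p :: "real \<times> real \<Rightarrow> 'a"
  assumes cont_p: "continuous_on UNIV p"
    and open_p: "open U \<Longrightarrow> openin (top_of_set X) (p ` U)"
    and range_p: "range p = X"
    and p_eq_iff: "p q = p q' \<longleftrightarrow> (\<exists>m n. q' = deck m n q)"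
    and F_nonempty: "F \<noteq> {}"
begin

lemma p_in_X [simp]: "p q \<in> X"
  using range_p by blast

lemma lift: assumes "x \<in> X" obtains q where "p q = x"
  using assms that unfolding range_p[symmetric] by blast

lemma p_deck [simp]: "p (deck m n q) = p q"
  using p_eq_iff by metis

text \<open>Two points of the ball are less than 1 apart, and distinct points of one orbit are
  not.\<close>

lemma inj_on_p_ball: "inj_on p (ball q (1/2))"
proof (rule inj_onI)
  fix a b assume ab: "a \<in> ball q (1/2)" "b \<in> ball q (1/2)" "p a = p b"
  then obtain m n where b: "b = deck m n a" using p_eq_iff by blast
  have "dist a b < 1" using ab by (simp add: dist_triangle_half_r)
  then have "dist (deck 0 0 a) (deck m n a) < 1" by (simp add: b)
  then have "0 = m" "0 = n" by (rule deck_eq_if_close)+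
  then show "a = b" using b by simp
qed

lemma connected_X: "connected X"
  using connected_continuous_image[OF cont_p] connected_UNIV range_p by metis

lemma connected_X_minus_V: "connected (X - V)"
proof -
  have "countable (p -` {v})" for v
  proof (cases "\<exists>q. p q = v")
    case True
    then obtain q where "p q = v" by blast
    have "p -` {v} \<subseteq> (\<lambda>(m, n). deck m n q) ` UNIV"
    proof
      fix a assume "a \<in> p -` {v}"
      then have "p q = p a" using \<open>p q = v\<close> by simp
      then obtain m n where "a = deck m n q" using p_eq_iff by blast
      then show "a \<in> (\<lambda>(m, n). deck m n q) ` UNIV" by (intro image_eqI[of _ _ "(m, n)"]) auto
    qed
    then show ?thesis by (rule countable_subset) auto
  next
    case False
    then have "p -` {v} = {}" by blast
    then show ?thesis by simp
  qed
  then have "countable (\<Union>v\<in>V. p -` {v})"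
    using finite_V by (intro countable_UN) (auto simp: countable_finite)
  then have "connected (- (\<Union>v\<in>V. p -` {v}))"
    by (intro path_connected_imp_connected path_connected_complement_countable) auto
  then have "connected (p ` (- (\<Union>v\<in>V. p -` {v})))"
    by (intro connected_continuous_image continuous_on_subset[OF cont_p]) auto
  moreover have "p ` (- (\<Union>v\<in>V. p -` {v})) = X - V"
    using range_p by auto
  ultimately show ?thesis by simp
qed

section \<open>Invariance of domain on \<open>X\<close> and the number of triangles at an
  edge\<close>

lemma open_vimage_p: "openin (top_of_set X) U \<Longrightarrow> open (p -` U)"
  using continuous_openin_preimage[OF cont_p, of X U] by simp

text \<open>Near each point \<open>p\<close> has a continuous local inverse \<open>i\<close>, and
  invariance of domain in the plane applies to \<open>i \<circ> f\<close>.\<close>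

lemma open_image_into_X:
  fixes f :: "real \<times> real \<Rightarrow> 'a"
  assumes "open S" "continuous_on S f" "inj_on f S" "f ` S \<subseteq> X"
  shows "openin (top_of_set X) (f ` S)"
proof (subst openin_subopen, intro ballI)
  fix y assume "y \<in> f ` S"
  then obtain z where z: "z \<in> S" "y = f z" by blast
  then obtain q where q: "p q = f z" using assms lift by blast
  define B where "B = ball q (1/2)"
  have B: "open B" "inj_on p B" "q \<in> B" using inj_on_p_ball by (auto simp: B_def)
  define i where "i = inv_into B p"
  have ip: "i (p b) = b" if "b \<in> B" for b using B that by (simp add: i_def)
  have "continuous_on (p ` B) i"
  proof (rule continuous_on_inverse_open_map)
    show "continuous_on B p" using cont_p continuous_on_subset by blast
    show "openin (top_of_set (p ` B)) (p ` U)" if "openin (top_of_set B) U" for U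
    proof -
      have "open U" "U \<subseteq> B" using that B by (auto simp: openin_open_eq)
      then show ?thesis
        by (intro openin_subset_trans[OF open_p]) auto
    qed
  qed (auto simp: ip)
  define S' where "S' = S \<inter> f -` (p ` B)"
  have "openin (top_of_set S) S'" unfolding S'_def
    using assms B open_p by (intro continuous_openin_preimage[where T = X]) auto
  then have "open S'" using assms openin_open_eq by blast
  have "open ((i \<circ> f) ` S')"
  proof (rule invariance_of_domain)
    show "continuous_on S' (i \<circ> f)"
      using assms \<open>continuous_on (p ` B) i\<close>
      by (intro continuous_on_compose) (auto simp: S'_def intro: continuous_on_subset)
    show "inj_on (i \<circ> f) S'"
    proof (rule inj_onI)
      fix a b assume ab: "a \<in> S'" "b \<in> S'" "(i \<circ> f) a = (i \<circ> f) b"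
      then have "f a = f b" by (auto simp: S'_def ip)
      then show "a = b" using ab assms by (auto simp: S'_def inj_on_def)
    qed
  qed fact
  then have "openin (top_of_set X) (p ` (i \<circ> f) ` S')" by (rule open_p)
  moreover have "p ` (i \<circ> f) ` S' = f ` S'"
    unfolding image_image by (intro image_cong) (auto simp: S'_def ip)
  moreover have "f z \<in> p ` B" using q B by (metis image_eqI)
  then have "y \<in> f ` S'" using z by (auto simp: S'_def)
  moreover have "f ` S' \<subseteq> f ` S" by (auto simp: S'_def)
  ultimately show "\<exists>T. openin (top_of_set X) T \<and> y \<in> T \<and> T \<subseteq> f ` S" by metis
qed

text \<open>On a small ball \<open>p\<close> is injective, so invariance of domain in the plane
  applies to \<open>f \<circ> p\<close>.\<close>

lemma open_image_from_X:
  fixes f :: "'a \<Rightarrow> real \<times> real"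
  assumes U: "openin (top_of_set X) U" and f: "continuous_on U f" "inj_on f U"
  shows "open (f ` U)"
proof (subst open_subopen, intro ballI)
  fix y assume "y \<in> f ` U"
  then obtain x where x: "x \<in> U" "y = f x" by blast
  then obtain q where q: "p q = x" using U openin_imp_subset lift by blast
  define B where "B = ball q (1/2) \<inter> p -` U"
  have "open B" unfolding B_def using open_vimage_p[OF U] by auto
  have "open ((f \<circ> p) ` B)"
  proof (rule invariance_of_domain)
    show "continuous_on B (f \<circ> p)"
      using f cont_p by (intro continuous_on_compose) (auto simp: B_def intro: continuous_on_subset)
    show "inj_on (f \<circ> p) B"
      using f inj_on_p_ball[of q] by (intro comp_inj_on) (auto simp: B_def intro: inj_on_subset)
  qed fact
  moreover have "y \<in> (f \<circ> p) ` B" using x q by (auto simp: B_def)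
  moreover have "(f \<circ> p) ` B \<subseteq> f ` U" by (auto simp: B_def)
  ultimately show "\<exists>T. open T \<and> y \<in> T \<and> T \<subseteq> f ` U" by blast
qed

text \<open>Invariance of domain: the point \<open>c\<close> would be sent to the boundary of a half plane by an open map.\<close>

lemma no_half_plane_chart:
  assumes U: "openin (top_of_set X) U" "c \<in> U"
    and inj: "\<And>x y. \<lbrakk>x \<in> U; y \<in> U; (x - c) \<bullet> d = (y - c) \<bullet> d; (x - c) \<bullet> n = (y - c) \<bullet> n\<rbrakk> \<Longrightarrow> x = y"
    and half: "\<And>x. x \<in> U \<Longrightarrow> (x - c) \<bullet> n \<ge> 0"
  shows False
proof -
  define f where "f x = ((x - c) \<bullet> d, (x - c) \<bullet> n)" for x
  have "open (f ` U)"
  proof (rule open_image_from_X[OF U(1)])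
    show "continuous_on U f" unfolding f_def by (intro continuous_intros)
    show "inj_on f U" by (rule inj_onI) (auto simp: f_def intro: inj)
  qed
  moreover have "(0, 0) \<in> f ` U" using U by (force simp: f_def)
  ultimately obtain e where e: "e > 0" "ball (0, 0) e \<subseteq> f ` U" by (metis openE)
  then have "(0, - e / 2) \<in> ball (0, 0) e" by (simp add: dist_Pair_Pair)
  then have "(0, - e / 2) \<in> f ` U" using e by blast
  then show False using half e(1) by (force simp: f_def)
qed

lemma triangle_over_edge:
  assumes "t \<in> F" "{v, w} \<subseteq> t" "v \<noteq> w"
  obtains u where "t = {v, w, u}" "u \<noteq> v" "u \<noteq> w"
proof -
  have "card (t - {v, w}) = 1" using assms by (simp add: F_def card_Diff_subset)
  then obtain u where "t - {v, w} = {u}" by (rule card_1_singletonE)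
  then show ?thesis using assms that[of u] by blast
qed

text \<open>With at most one triangle over the edge, its open star \<open>U\<close> lies in that
  edge or triangle. The coordinates along the edge and normal to it then embed \<open>U\<close> in a
  closed half plane, with the midpoint on the boundary line.\<close>

lemma edge_in_two_triangles:
  assumes vw: "{v, w} \<in> K" "v \<noteq> w"
  shows "\<exists>t\<in>F. \<exists>s\<in>F. t \<noteq> s \<and> {v, w} \<subseteq> t \<and> {v, w} \<subseteq> s"
proof (rule ccontr)
  assume none: "\<not> ?thesis"
  let ?m = "midpoint v w"
  define U where "U = {x \<in> X. v \<in> car x} \<inter> {x \<in> X. w \<in> car x}"
  have U: "openin (top_of_set X) U" unfolding U_def by (intro openin_Int open_star)
  have m: "?m \<in> U" using edge_midpoint[OF vw(1)] by (simp add: U_def)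
  have dd: "(w - v) \<bullet> (w - v) \<noteq> 0" using vw by simp
  have car_cases: "car x = {v, w} \<or> car x \<in> F" if "x \<in> U" for x
  proof -
    have c: "car x \<in> K" "{v, w} \<subseteq> car x" using that car_in_K_hull by (auto simp: U_def)
    then have "card {v, w} \<le> card (car x)" using finite_simplex card_mono by blast
    then consider "card (car x) = 2" | "card (car x) = 3" using card_le_3[OF c(1)] vw by fastforce
    then show ?thesis
    proof cases
      case 1 then show ?thesis using c vw card_subset_eq[of "car x" "{v, w}"] finite_simplex by auto
    qed (use c in \<open>auto simp: F_def\<close>)
  qed
  show False
  proof (cases "\<exists>t\<in>F. {v, w} \<subseteq> t")
    case False
    have coords: "\<exists>s. x = ?m + s *\<^sub>R (w - v)" if "x \<in> U" for x
    proof -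
      have "{v, w} \<subseteq> car x" using that by (auto simp: U_def)
      then have "car x = {v, w}" using car_cases[OF that] False by blast
      then show ?thesis using car_in_K_hull(2)[of x] that hull2_coords[of x v w] by (metis (no_types, lifting) IntD1 U_def mem_Collect_eq)
    qed
    \<comment> \<open>Without any triangle the star lies on a line, and the normal
      \<open>n = 0\<close> gives a degenerate chart with second coordinate 0.\<close>
    show False
    proof (rule no_half_plane_chart[OF U m, where d = "w - v" and n = 0])
      fix x y assume "x \<in> U" "y \<in> U" and eq: "(x - ?m) \<bullet> (w - v) = (y - ?m) \<bullet> (w - v)"
      then obtain s s' where "x = ?m + s *\<^sub>R (w - v)" "y = ?m + s' *\<^sub>R (w - v)"
        using coords by metis
      then show "x = y" using eq dd by simp
    qed auto
  next
    case True
    then obtain t where t: "t \<in> F" "{v, w} \<subseteq> t" by blast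
    obtain u where u: "t = {v, w, u}" "u \<noteq> v" "u \<noteq> w" using triangle_over_edge[OF t vw(2)] .
    have "\<not> affine_dependent {v, w, u}" using t u indep by (auto simp: F_def)
    then obtain n where n: "(w - v) \<bullet> n = 0" "(u - ?m) \<bullet> n > 0"
      using triangle_normal vw u by metis
    have coords: "\<exists>a b. b \<ge> 0 \<and> x = ?m + a *\<^sub>R (w - v) + b *\<^sub>R (u - ?m)" if "x \<in> U" for x
    proof -
      have "{v, w} \<subseteq> car x" "x \<in> X" using that by (auto simp: U_def)
      have "car x \<subseteq> {v, w, u}"
        using car_cases[OF that]
      proof
        assume "car x \<in> F"
        then have "car x = t" using none t \<open>{v, w} \<subseteq> car x\<close> by metis
        then show ?thesis using u by simp
      qed auto
      then have "x \<in> convex hull {v, w, u}"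
        using car_in_K_hull(2)[OF \<open>x \<in> X\<close>] hull_mono by blast
      then show ?thesis using hull3_coords by metis
    qed
    show False
    proof (rule no_half_plane_chart[OF U m, where d = "w - v" and n = n])
      fix x y assume xy: "x \<in> U" "y \<in> U" and eq: "(x - ?m) \<bullet> (w - v) = (y - ?m) \<bullet> (w - v)"
        "(x - ?m) \<bullet> n = (y - ?m) \<bullet> n"
      obtain a b where x: "x = ?m + a *\<^sub>R (w - v) + b *\<^sub>R (u - ?m)"
        using coords[OF xy(1)] by blast
      obtain a' b' where y: "y = ?m + a' *\<^sub>R (w - v) + b' *\<^sub>R (u - ?m)"
        using coords[OF xy(2)] by blast
      have "b = b'" using eq(2) n unfolding x y by (simp add: inner_add_left)
      then have "a = a'" using eq(1) dd unfolding x y by (simp add: inner_add_left)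
      then show "x = y" using \<open>b = b'\<close> x y by simp
    next
      fix x assume "x \<in> U"
      then obtain a b where x: "b \<ge> 0" "x = ?m + a *\<^sub>R (w - v) + b *\<^sub>R (u - ?m)"
        using coords by blast
      then show "(x - ?m) \<bullet> n \<ge> 0" using n by (simp add: inner_add_left)
    qed
  qed
qed

lemma edge_not_in_three_triangles:
  assumes vw: "{v, w} \<in> K" "v \<noteq> w" and t: "t1 \<in> F" "t2 \<in> F" "t3 \<in> F"
    and e: "{v, w} \<subseteq> t1" "{v, w} \<subseteq> t2" "{v, w} \<subseteq> t3" and ne: "t1 \<noteq> t2" "t1 \<noteq> t3" "t2 \<noteq> t3"
  shows False
proof -
  define m where "m = midpoint v w"
  define d where "d = w - v"
  obtain u1 where u1: "t1 = {v, w, u1}" "u1 \<noteq> v" "u1 \<noteq> w"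
    using triangle_over_edge[OF t(1) e(1) vw(2)] .
  obtain u2 where u2: "t2 = {v, w, u2}" "u2 \<noteq> v" "u2 \<noteq> w"
    using triangle_over_edge[OF t(2) e(2) vw(2)] .
  obtain u3 where u3: "t3 = {v, w, u3}" "u3 \<noteq> v" "u3 \<noteq> w"
    using triangle_over_edge[OF t(3) e(3) vw(2)] .
  have tK: "t1 \<in> K" "t2 \<in> K" "t3 \<in> K" using t by (auto simp: F_def)
  obtain n1 where n1: "d \<bullet> n1 = 0" "(u1 - m) \<bullet> n1 > 0"
    using triangle_normal[of v w u1] indep[OF tK(1)] u1 vw unfolding d_def m_def by metis
  obtain n2 where n2: "d \<bullet> n2 = 0" "(u2 - m) \<bullet> n2 > 0"
    using triangle_normal[of v w u2] indep[OF tK(2)] u2 vw unfolding d_def m_def by metis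
  obtain n3 where n3: "d \<bullet> n3 = 0" "(u3 - m) \<bullet> n3 > 0"
    using triangle_normal[of v w u3] indep[OF tK(3)] u3 vw unfolding d_def m_def by metis
  have dd: "d \<noteq> 0" using vw by (simp add: d_def)
  have meet: "x \<in> convex hull {v, w}"
    if h: "x \<in> convex hull s" "x \<in> convex hull s'" "s \<in> F" "s' \<in> F" "{v, w} \<subseteq> s" "{v, w} \<subseteq> s'" "s \<noteq> s'" for x s s'
  proof -
    obtain a where a: "s = {v, w, a}" "a \<noteq> v" "a \<noteq> w"
      using triangle_over_edge[OF h(3,5) vw(2)] .
    obtain b where b: "s' = {v, w, b}" "b \<noteq> v" "b \<noteq> w"
      using triangle_over_edge[OF h(4,6) vw(2)] .
    have "s \<inter> s' = {v, w}" using a b h(7) by auto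
    then show ?thesis using hull_Int[of s s'] h by (auto simp: F_def)
  qed
  have edge0: "(x - m) \<bullet> n = 0" if h: "x \<in> convex hull {v, w}" "d \<bullet> n = 0" for x n
  proof -
    obtain s where "x = midpoint v w + s *\<^sub>R (w - v)" using hull2_coords[OF h(1)] .
    then show ?thesis using h by (simp add: m_def d_def)
  qed
  \<comment> \<open>A plane chart at \<open>m\<close> built from two of the triangles; its image is open in \<open>X\<close>, so it would
    contain points of the third triangle.\<close>
  define f where "f q = m + fst q *\<^sub>R d + max (snd q) 0 *\<^sub>R (u1 - m) + max (- snd q) 0 *\<^sub>R (u2 - m)" for q :: "real \<times> real"
  have f_inner: "(f q - m) \<bullet> n = fst q * (d \<bullet> n) + max (snd q) 0 * ((u1 - m) \<bullet> n) + max (- snd q) 0 * ((u2 - m) \<bullet> n)" for q n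
    unfolding f_def by (simp only: add.assoc add_diff_cancel_left' inner_add_left inner_scaleR_left)
  \<comment> \<open>Both coordinates stay below 1/4, so \<open>2 * \<bar>s\<bar> + t\<close> is less
    than 3/4 and \<open>hull3_coords_converse\<close> applies in either triangle.\<close>
  define S where "S = ball (0::real \<times> real) (1/4)"
  have S: "\<bar>fst q\<bar> < 1/4" "\<bar>snd q\<bar> < 1/4" if "q \<in> S" for q
    using that dist_fst_le[of "(0,0)" q] dist_snd_le[of "(0,0)" q]
    by (auto simp: S_def dist_real_def zero_prod_def intro: le_less_trans)
  have f1: "f q \<in> convex hull t1" if "q \<in> S" "snd q \<ge> 0" for q
    using hull3_coords_converse[of "snd q" "fst q" v w u1] that S[of q] u1
    by (simp add: f_def m_def d_def)
  have f2: "f q \<in> convex hull t2" if "q \<in> S" "snd q \<le> 0" for q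
    using hull3_coords_converse[of "- snd q" "fst q" v w u2] that S[of q] u2
    by (simp add: f_def m_def d_def)
  have "openin (top_of_set X) (f ` S)"
  proof (rule open_image_into_X)
    show "open S" by (simp add: S_def)
    show "continuous_on S f" unfolding f_def by (intro continuous_intros)
    show "f ` S \<subseteq> X" using f1 f2 tK in_X by (metis image_subsetI linear)
    \<comment> \<open>A common value would lie on the edge, where the \<open>n2\<close>-coordinate
      vanishes, whereas at \<open>f r\<close> it is positive.\<close>
    have mixed: False if "q \<in> S" "r \<in> S" "snd q \<ge> 0" "snd r < 0" "f q = f r" for q r
    proof -
      have "f r \<in> convex hull {v, w}"
        using f1[of q] f2[of r] that t e ne by (intro meet[of _ t1 t2]) auto
      then have "(f r - m) \<bullet> n2 = 0" using edge0 n2 by blast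
      then show False using n2 that by (simp add: f_inner)
    qed
    show "inj_on f S"
    proof (rule inj_onI)
      fix q r assume qr: "q \<in> S" "r \<in> S" "f q = f r"
      have snd: "snd q = snd r"
      proof (cases "snd q \<ge> 0"; cases "snd r \<ge> 0")
        assume *: "snd q \<ge> 0" "snd r \<ge> 0"
        have "(f q - m) \<bullet> n1 = (f r - m) \<bullet> n1" using qr by simp
        then show ?thesis using * n1 by (simp add: f_inner)
      next
        assume *: "\<not> snd q \<ge> 0" "\<not> snd r \<ge> 0"
        have "(f q - m) \<bullet> n2 = (f r - m) \<bullet> n2" using qr by simp
        then show ?thesis using * n2 by (simp add: f_inner)
      qed (use mixed[of q r] mixed[of r q] qr in auto)
      then have "fst q *\<^sub>R d = fst r *\<^sub>R d" using qr by (simp add: f_def)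
      then show "q = r" using snd dd by (simp add: prod_eq_iff)
    qed
  qed
  moreover have "f 0 = m" by (simp add: f_def)
  then have "m \<in> f ` S" by (force simp: S_def)
  ultimately obtain \<epsilon> where \<epsilon>: "\<epsilon> > 0" "ball m \<epsilon> \<inter> X \<subseteq> f ` S"
    by (metis openin_contains_ball)
  \<comment> \<open>The bound 1 keeps \<open>x\<close> in the third triangle, the other bound keeps
    it within \<epsilon> of \<open>m\<close>; being positive, \<eta> moves \<open>x\<close> off the
    edge.\<close>
  define \<eta> where "\<eta> = min 1 (\<epsilon> / (2 * norm (u3 - m)))"
  define x where "x = m + \<eta> *\<^sub>R (u3 - m)"
  have "u3 \<noteq> m" using n3 by auto
  then have \<eta>: "\<eta> > 0" "\<eta> \<le> 1" using \<epsilon> by (auto simp: \<eta>_def)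
  have "\<eta> * norm (u3 - m) \<le> \<epsilon> / (2 * norm (u3 - m)) * norm (u3 - m)"
    by (intro mult_right_mono) (auto simp: \<eta>_def)
  also have "\<dots> < \<epsilon>" using \<open>u3 \<noteq> m\<close> \<epsilon> by simp
  finally have "x \<in> ball m \<epsilon>" using \<eta> by (simp add: x_def dist_norm)
  moreover have x3: "x \<in> convex hull t3"
    using hull3_coords_converse[of \<eta> 0 v w u3] \<eta> by (simp add: x_def u3 m_def)
  ultimately have "x \<in> f ` S" using \<epsilon> in_X tK by blast
  then have "x \<in> convex hull t1 \<or> x \<in> convex hull t2" using f1 f2 by (metis imageE linear)
  then have "x \<in> convex hull {v, w}"
    using meet[of x t1 t3] meet[of x t2 t3] x3 t e ne by blast
  then have "(x - m) \<bullet> n3 = 0" using edge0 n3 by blast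
  then show False using n3 \<eta> by (simp add: x_def)
qed

lemma edge_triangles:
  assumes "e \<in> E"
  obtains t s where "t \<in> F" "s \<in> F" "t \<noteq> s" "{r \<in> F. e \<subseteq> r} = {t, s}"
proof -
  obtain v w where vw: "v \<noteq> w" "e = {v, w}" "{v, w} \<in> K" using assms E_iff by blast
  obtain t s where ts: "t \<in> F" "s \<in> F" "t \<noteq> s" "e \<subseteq> t" "e \<subseteq> s"
    using edge_in_two_triangles vw by metis
  moreover have "r = t \<or> r = s" if "r \<in> F" "e \<subseteq> r" for r
    using edge_not_in_three_triangles[of v w r t s] that ts vw by blast
  ultimately show ?thesis using that[of t s] by auto
qed

end

section \<open>Cochains\<close>

lemma compact_unit_square: "compact unit_square"
  unfolding unit_square_def by (intro compact_Times) auto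

lemma deck_into_unit_square: "\<exists>m n. deck m n q \<in> unit_square"
proof -
  \<comment> \<open>The vertical shift may reflect the first coordinate, so the horizontal shift is
    computed from the reflected value.\<close>
  define x where "x = par (- \<lfloor>snd q\<rfloor>) * fst q"
  have "deck (- \<lfloor>x\<rfloor>) (- \<lfloor>snd q\<rfloor>) q = (x - \<lfloor>x\<rfloor>, snd q - \<lfloor>snd q\<rfloor>)"
    by (simp add: deck_def x_def)
  also have "\<dots> \<in> unit_square"
    unfolding unit_square_def by (auto; linarith)
  finally show ?thesis by blast
qed

context klein_cover
begin

definition d0 :: "('a \<Rightarrow> bit) \<Rightarrow> 'a set \<Rightarrow> bit" where
  "d0 d = (\<lambda>e. if e \<in> E then \<Sum>v\<in>e. d v else 0)"

definition d1 :: "('a set \<Rightarrow> bit) \<Rightarrow> 'a set \<Rightarrow> bit" where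
  "d1 c = (\<lambda>t. if t \<in> F then \<Sum>e | e \<in> E \<and> e \<subseteq> t. c e else 0)"

definition Z1 :: "('a set \<Rightarrow> bit) set" where "Z1 = {c \<in> supp_fun E. d1 c = 0}"
definition B1 :: "('a set \<Rightarrow> bit) set" where "B1 = d0 ` supp_fun V"

section \<open>The coboundary operators, their kernels and images\<close>

lemma d0_add: "d0 (x + y) = d0 x + d0 y"
  by (rule ext) (simp add: d0_def sum.distrib)

lemma d1_add: "d1 (x + y) = d1 x + d1 y"
  by (rule ext) (simp add: d1_def sum.distrib)

lemma d0_edge: "{v, w} \<in> K \<Longrightarrow> v \<noteq> w \<Longrightarrow> d0 d {v, w} = d v + d w"
  by (simp add: d0_def E_def)

lemma V_nonempty: "V \<noteq> {}"
proof -
  obtain t where "t \<in> K" "t \<noteq> {}" using F_nonempty by (force simp: F_def)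
  then show ?thesis by (auto simp: V_eq)
qed

text \<open>A kernel element of \<open>d0\<close> is constant along edges, hence constant on
  \<open>V\<close> by connectedness; this leaves 0 and the indicator \<open>i\<close> of
  \<open>V\<close>.\<close>

lemma card_V_B1: "2 ^ card V = 2 * card B1"
proof -
  define i where "i = (\<lambda>v. if v \<in> V then 1 else 0 :: bit)"
  have "{d \<in> supp_fun V. d0 d = 0} = {0, i}"
  proof (intro equalityI subsetI)
    fix d assume d: "d \<in> {d \<in> supp_fun V. d0 d = 0}"
    define Y where "Y = {v \<in> V. d v = 1}"
    have "Y = V" if "Y \<noteq> {}"
    proof (rule V_connected[OF connected_X _ that])
      fix v w assume v: "v \<in> Y" and vw: "{v, w} \<in> K"
      show "w \<in> Y"
      proof (cases "v = w")
        case False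
        then have "d0 d {v, w} = d v + d w" using d0_edge vw by blast
        then have "d w = 1" using d v by (simp add: Y_def bit_add_eq_0_iff)
        then show ?thesis using vw by (auto simp: Y_def V_eq)
      qed (use v in simp)
    qed (auto simp: Y_def)
    then show "d \<in> {0, i}"
      using d by (cases "Y = {}") (auto simp: Y_def i_def supp_fun_def fun_eq_iff)
  next
    fix d assume "d \<in> {0, i}"
    moreover have "d0 0 = 0" by (rule ext) (simp add: d0_def)
    moreover have "i \<in> supp_fun V" by (simp add: i_def supp_fun_def)
    moreover have "d0 i = 0"
    proof
      fix e
      show "d0 i e = 0 e"
      proof (cases "e \<in> E")
        case True
        then obtain v w where "v \<noteq> w" "e = {v, w}" "{v, w} \<in> K" using E_iff by blast
        then show ?thesis using d0_edge[of v w i] by (auto simp: i_def V_eq)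
      qed (simp add: d0_def)
    qed
    ultimately show "d \<in> {d \<in> supp_fun V. d0 d = 0}" by auto
  qed
  moreover have "0 \<noteq> i" using V_nonempty by (auto simp: i_def fun_eq_iff)
  ultimately have "card {d \<in> supp_fun V. d0 d = 0} = 2" by simp
  then show ?thesis
    using card_eq_card_kernel_times_card_image[of "supp_fun V" d0] finite_V
    by (simp add: supp_fun_add d0_add card_supp_fun B1_def)
qed

text \<open>Every edge value is counted in exactly two triangles, so coboundaries sum to 0.
  Conversely a single edge yields the sum of the indicators of its two triangles; chains of such
  edges join any triangle to a fixed \<open>t0\<close>, and the sums \<open>i t + i t0\<close>
  generate all cochains of even weight.\<close>

lemma d1_image: "d1 ` supp_fun E = {f \<in> supp_fun F. (\<Sum>t\<in>F. f t) = 0}" (is "?I = ?J")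
proof (intro equalityI subsetI)
  fix f assume "f \<in> ?I"
  then obtain c where f: "f = d1 c" by blast
  have "(\<Sum>t\<in>F. f t) = (\<Sum>t\<in>F. \<Sum>e | e \<in> E \<and> e \<subseteq> t. c e)"
    by (simp add: f d1_def)
  also have "\<dots> = (\<Sum>e\<in>E. \<Sum>t | t \<in> F \<and> e \<subseteq> t. c e)"
    by (rule sum.swap_restrict[OF finite_F finite_E])
  also have "\<dots> = (\<Sum>e\<in>E. 0)"
  proof (rule sum.cong)
    fix e assume "e \<in> E"
    then obtain t s where "t \<noteq> s" "{r \<in> F. e \<subseteq> r} = {t, s}" by (rule edge_triangles)
    then show "(\<Sum>t | t \<in> F \<and> e \<subseteq> t. c e) = 0" by simp
  qed simp
  finally show "f \<in> ?J" by (simp add: f supp_fun_def d1_def)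
next
  define i :: "'a set \<Rightarrow> 'a set \<Rightarrow> bit" where "i t = (\<lambda>s. if s = t then 1 else 0)" for t
  have zero: "0 \<in> ?I" by (rule image_eqI[of _ _ 0]) (auto simp: d1_def fun_eq_iff)
  have add: "x + y \<in> ?I" if xy: "x \<in> ?I" "y \<in> ?I" for x y
  proof -
    obtain a b where ab: "a \<in> supp_fun E" "b \<in> supp_fun E" "x = d1 a" "y = d1 b" using xy by blast
    then have "x + y = d1 (a + b)" by (simp add: d1_add)
    then show ?thesis using supp_fun_add[OF ab(1,2)] by (rule image_eqI)
  qed
  have edge: "i t + i s \<in> ?I" if "e \<in> E" "{r \<in> F. e \<subseteq> r} = {t, s}" "t \<noteq> s" for e t s
  proof (rule image_eqI[of _ _ "i e"])
    show "i e \<in> supp_fun E" using that by (simp add: supp_fun_def i_def)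
    show "i t + i s = d1 (i e)"
    proof
      fix r
      have "d1 (i e) r = (if r \<in> F \<and> e \<subseteq> r then 1 else 0)"
        using that finite_E by (simp add: d1_def i_def sum.delta)
      also have "r \<in> F \<and> e \<subseteq> r \<longleftrightarrow> r = t \<or> r = s" using that by blast
      finally show "(i t + i s) r = d1 (i e) r" using that by (simp add: i_def)
    qed
  qed
  obtain t0 where t0: "t0 \<in> F" using F_nonempty by blast
  define Y where "Y = {t \<in> F. i t + i t0 \<in> ?I}"
  have "Y = F"
  proof (rule F_connected[OF connected_X_minus_V])
    have "i t0 + i t0 = 0" by (rule ext) simp
    then show "Y \<noteq> {}" using t0 zero by (auto simp: Y_def)
    show "\<exists>t\<in>F. e \<subseteq> t" if "e \<in> E" for e using that by (rule edge_triangles) blast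
    show "s \<in> Y" if *: "e \<in> E" "t \<in> Y" "s \<in> F" "e \<subseteq> t" "e \<subseteq> s" for e t s
    proof (cases "t = s")
      case False
      obtain t' s' where eq: "t' \<noteq> s'" "{r \<in> F. e \<subseteq> r} = {t', s'}"
        using edge_triangles[OF *(1)] by metis
      have "t \<in> {r \<in> F. e \<subseteq> r}" "s \<in> {r \<in> F. e \<subseteq> r}"
        using * by (auto simp: Y_def)
      then have "{r \<in> F. e \<subseteq> r} = {s, t}" using False unfolding eq by auto
      then have "i s + i t \<in> ?I" using edge * False by metis
      moreover have "i t + i t0 \<in> ?I" using * by (simp add: Y_def)
      ultimately have "(i s + i t) + (i t + i t0) \<in> ?I" by (rule add)
      moreover have "(i s + i t) + (i t + i t0) = i s + i t0" by (rule ext) (simp add: add.assoc)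
      ultimately show ?thesis using * by (simp add: Y_def)
    qed (use * in simp)
  qed (auto simp: Y_def)
  fix f assume f: "f \<in> ?J"
  \<comment> \<open>The restriction of \<open>f\<close> to \<open>A\<close> is corrected at
    \<open>t0\<close> to even weight. For \<open>A = F\<close> the correction vanishes.\<close>
  have "(\<lambda>s. if s \<in> A then f s else 0) + (\<lambda>s. if s = t0 then (\<Sum>t\<in>A. f t) else 0) \<in> ?I"
    if "A \<subseteq> F" for A
    using finite_subset[OF that finite_F] that
  proof (induction rule: finite_induct)
    case empty
    have "(\<lambda>s. if s \<in> {} then f s else 0) + (\<lambda>s. if s = t0 then (\<Sum>t\<in>{}. f t) else 0) = 0"
      by (rule ext) simp
    then show ?case using zero by (simp only:)
  next
    case (insert a A)
    let ?h = "\<lambda>A. (\<lambda>s. if s \<in> A then f s else 0) + (\<lambda>s. if s = t0 then (\<Sum>t\<in>A. f t) else 0)"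
    have IH: "?h A \<in> ?I" using insert.prems by (intro insert.IH) simp
    show ?case
    proof (cases "f a = 0")
      case True
      then have "?h (insert a A) = ?h A" using insert by (auto simp: fun_eq_iff)
      then show ?thesis using IH by (simp only:)
    next
      case False
      then have "?h (insert a A) = (i a + i t0) + ?h A"
        using insert(1,2) by (auto simp: fun_eq_iff i_def)
      moreover have "i a + i t0 \<in> ?I" using insert \<open>Y = F\<close> by (auto simp: Y_def)
      ultimately show ?thesis using IH add by (simp only:)
    qed
  qed
  from this[of F] have "(\<lambda>s. if s \<in> F then f s else 0) + (\<lambda>s. if s = t0 then (\<Sum>t\<in>F. f t) else 0) \<in> ?I"
    by simp
  moreover have "(\<lambda>s. if s \<in> F then f s else 0) + (\<lambda>s. if s = t0 then (\<Sum>t\<in>F. f t) else 0) = f"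
    using f by (auto simp: supp_fun_def fun_eq_iff)
  ultimately show "f \<in> ?I" by (simp only:)
qed

lemma card_F_image: "2 ^ card F = card (d1 ` supp_fun E) * 2"
proof -
  have "(\<lambda>f. \<Sum>t\<in>F. f t) ` supp_fun F = (UNIV :: bit set)"
  proof -
    obtain t0 where t0: "t0 \<in> F" using F_nonempty by blast
    have "b \<in> (\<lambda>f. \<Sum>t\<in>F. f t) ` supp_fun F" for b :: bit
      using t0 finite_F by (intro image_eqI[of _ _ "\<lambda>t. if t = t0 then b else 0"]) (auto simp: supp_fun_def)
    then show ?thesis by blast
  qed
  then have "card ((\<lambda>f. \<Sum>t\<in>F. f t) ` supp_fun F :: bit set) = 2" by (simp add: card_UNIV_bit)
  then show ?thesis
    using card_eq_card_kernel_times_card_image[of "supp_fun F" "\<lambda>f. \<Sum>t\<in>F. f t"] finite_F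
    by (simp add: supp_fun_add card_supp_fun d1_image sum.distrib)
qed

lemma card_E_Z1: "2 ^ card E = card Z1 * card (d1 ` supp_fun E)"
  using card_eq_card_kernel_times_card_image[of "supp_fun E" d1] finite_E
  by (simp add: supp_fun_add d1_add card_supp_fun Z1_def)

lemma d1_triangle:
  assumes "{u, v, w} \<in> F"
  shows "d1 c {u, v, w} = c {u, v} + c {v, w} + c {u, w}"
proof -
  have K: "{u, v, w} \<in> K" and card: "card {u, v, w} = 3" using assms by (auto simp: F_def)
  then have ne: "u \<noteq> v" "v \<noteq> w" "u \<noteq> w" by (auto simp: card_insert_if split: if_splits)
  have "{e. e \<in> E \<and> e \<subseteq> {u, v, w}} = {{u, v}, {v, w}, {u, w}}"
  proof (intro equalityI subsetI)
    fix e assume "e \<in> {e. e \<in> E \<and> e \<subseteq> {u, v, w}}"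
    then obtain a b where "a \<noteq> b" "e = {a, b}" "a \<in> {u, v, w}" "b \<in> {u, v, w}"
      by (auto simp: E_iff)
    then show "e \<in> {{u, v}, {v, w}, {u, w}}" by (auto simp: insert_commute)
  next
    fix e assume "e \<in> {{u, v}, {v, w}, {u, w}}"
    then show "e \<in> {e. e \<in> E \<and> e \<subseteq> {u, v, w}}"
      using ne subset_in_K[OF K] by (auto simp: E_def)
  qed
  moreover have "{u, v} \<noteq> {v, w}" "{u, v} \<noteq> {u, w}" "{v, w} \<noteq> {u, w}"
    using ne by (auto simp: doubleton_eq_iff)
  ultimately show ?thesis using assms by (simp add: d1_def add.assoc)
qed

lemma B1_subset_Z1: "B1 \<subseteq> Z1"
proof
  fix c assume "c \<in> B1"
  then obtain d where c: "c = d0 d" by (auto simp: B1_def)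
  have "d1 c t = 0" for t
  proof (cases "t \<in> F")
    case True
    then have t: "t \<in> K" "card t = 3" by (auto simp: F_def)
    then obtain u v w where uvw: "t = {u, v, w}" "u \<noteq> v" "v \<noteq> w" "u \<noteq> w"
      by (metis card_3_iff)
    have "{u, v} \<in> K" "{v, w} \<in> K" "{u, w} \<in> K" using t uvw subset_in_K[of t] by auto
    then have "d0 d {u, v} = d u + d v" "d0 d {v, w} = d v + d w" "d0 d {u, w} = d u + d w"
      using d0_edge uvw by auto
    then show ?thesis using d1_triangle[of u v w c] True uvw c
      by (simp add: ac_simps)
  qed (simp add: d1_def)
  then show "c \<in> Z1" by (auto simp: Z1_def c supp_fun_def d0_def)
qed

section \<open>Cocycles and their monodromy\<close>

text \<open>A cocycle \<open>c\<close> describes a double covering of \<open>X\<close> with transition \<open>c {v, w}\<close> between the open stars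
  of \<open>v\<close> and \<open>w\<close>. The function \<open>g\<close> trivialises its pull-back to the plane, and \<open>a\<close>, \<open>b\<close> measure
  how the trivialisation changes under the two generators of the deck group.\<close>

definition has_monodromy :: "('a set \<Rightarrow> bit) \<Rightarrow> bit \<Rightarrow> bit \<Rightarrow> bool" where
  "has_monodromy c a b \<longleftrightarrow> (\<exists>g.
     (\<forall>q. \<forall>v\<in>car (p q). \<forall>w\<in>car (p q). v \<noteq> w \<longrightarrow> g q v + g q w = c {v, w}) \<and>
     (\<forall>q. \<forall>v\<in>car (p q). \<forall>\<^sub>F q' in nhds q. g q' v = g q v) \<and>
     (\<forall>q. \<forall>v\<in>car (p q). g (deck 1 0 q) v = g q v + a \<and> g (deck 0 1 q) v = g q v + b))"

lemma open_vimage_star: "open {q. v \<in> car (p q)}"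
proof -
  have "{q. v \<in> car (p q)} = p -` {x \<in> X. v \<in> car x}" by auto
  then show ?thesis using open_vimage_p[OF open_star] by simp
qed

lemma eventually_in_star: "v \<in> car (p q) \<Longrightarrow> \<forall>\<^sub>F q' in nhds q. v \<in> car (p q')"
  using open_vimage_star[of v] by (auto simp: eventually_nhds)

lemma has_monodromy_add:
  assumes "has_monodromy c a b" "has_monodromy c' a' b'"
  shows "has_monodromy (c + c') (a + a') (b + b')"
proof -
  obtain g where g: "\<And>q v w. \<lbrakk>v \<in> car (p q); w \<in> car (p q); v \<noteq> w\<rbrakk> \<Longrightarrow> g q v + g q w = c {v, w}"
    "\<And>q v. v \<in> car (p q) \<Longrightarrow> \<forall>\<^sub>F q' in nhds q. g q' v = g q v"
    "\<And>q v. v \<in> car (p q) \<Longrightarrow> g (deck 1 0 q) v = g q v + a \<and> g (deck 0 1 q) v = g q v + b"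
    using assms(1) unfolding has_monodromy_def by blast
  obtain g' where g': "\<And>q v w. \<lbrakk>v \<in> car (p q); w \<in> car (p q); v \<noteq> w\<rbrakk> \<Longrightarrow> g' q v + g' q w = c' {v, w}"
    "\<And>q v. v \<in> car (p q) \<Longrightarrow> \<forall>\<^sub>F q' in nhds q. g' q' v = g' q v"
    "\<And>q v. v \<in> car (p q) \<Longrightarrow> g' (deck 1 0 q) v = g' q v + a' \<and> g' (deck 0 1 q) v = g' q v + b'"
    using assms(2) unfolding has_monodromy_def by blast
  show ?thesis
    unfolding has_monodromy_def
  proof (intro exI[of _ "\<lambda>q v. g q v + g' q v"] conjI allI ballI impI)
    fix q v assume v: "v \<in> car (p q)"
    show "g q v + g' q v + (g q w + g' q w) = (c + c') {v, w}" if "w \<in> car (p q)" "v \<noteq> w" for w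
    proof -
      have "g q v + g' q v + (g q w + g' q w) = (g q v + g q w) + (g' q v + g' q w)"
        by (simp add: ac_simps)
      then show ?thesis using g(1) g'(1) v that by simp
    qed
    show "\<forall>\<^sub>F q' in nhds q. g q' v + g' q' v = g q v + g' q v"
      using g(2)[OF v] g'(2)[OF v] by eventually_elim simp
    show "g (deck 1 0 q) v + g' (deck 1 0 q) v = g q v + g' q v + (a + a')"
      "g (deck 0 1 q) v + g' (deck 0 1 q) v = g q v + g' q v + (b + b')"
      using g(3)[OF v] g'(3)[OF v] by (simp_all add: ac_simps)
  qed
qed

text \<open>One star chart chosen at each point of the plane, with no continuity; the jumps have to
  cancel in whatever is built from it.\<close>

definition ch :: "real \<times> real \<Rightarrow> 'a" where "ch q = (SOME v. v \<in> car (p q))"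

lemma ch_in_car: "ch q \<in> car (p q)"
  unfolding ch_def using car_nonempty[OF p_in_X] by (rule some_in_eq[THEN iffD2])

lemma car_edge:
  assumes "v \<in> car (p q)" "w \<in> car (p q)"
  shows "{v, w} \<in> K"
  using assms car_in_K_hull(1)[OF p_in_X, of q] subset_in_K by simp

lemma constant_if_locally_constant:
  fixes s :: "real \<times> real \<Rightarrow> 'c"
  assumes "\<And>q. \<forall>\<^sub>F q' in nhds q. s q' = s q"
  shows "s q = s r"
proof (rule connected_local_const[where A = UNIV])
  show "\<forall>a\<in>UNIV. \<forall>\<^sub>F b in at a. s a = s b"
  proof
    fix a
    show "\<forall>\<^sub>F b in at a. s a = s b"
      using assms[of a] unfolding eventually_at_filter by (rule eventually_mono) auto
  qed
qed auto

text \<open>For a coboundary, \<open>g q v + d v\<close> is the same for all vertices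
  \<open>v\<close> of the carrier. It is thus a locally constant function on the plane, hence
  constant, while the generators add \<open>a\<close> and \<open>b\<close> to it.\<close>

lemma has_monodromy_coboundary:
  assumes "has_monodromy (d0 d) a b"
  shows "a = 0" "b = 0"
proof -
  obtain g where g: "\<And>q v w. \<lbrakk>v \<in> car (p q); w \<in> car (p q); v \<noteq> w\<rbrakk> \<Longrightarrow> g q v + g q w = d0 d {v, w}"
    "\<And>q v. v \<in> car (p q) \<Longrightarrow> \<forall>\<^sub>F q' in nhds q. g q' v = g q v"
    "\<And>q v. v \<in> car (p q) \<Longrightarrow> g (deck 1 0 q) v = g q v + a \<and> g (deck 0 1 q) v = g q v + b"
    using assms unfolding has_monodromy_def by blast
  define s where "s q = g q (ch q) + d (ch q)" for q
  have s: "s q = g q v + d v" if "v \<in> car (p q)" for q v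
  proof (cases "v = ch q")
    case False
    then have "g q v + g q (ch q) = d v + d (ch q)"
      using g(1)[OF that ch_in_car] d0_edge car_edge[OF that ch_in_car] by metis
    then show ?thesis unfolding s_def by (metis add.commute add.left_commute bit_add_self(2))
  qed (simp add: s_def)
  have const: "s q = s r" for q r
  proof (rule constant_if_locally_constant)
    fix q
    show "\<forall>\<^sub>F q' in nhds q. s q' = s q"
      using g(2)[OF ch_in_car] eventually_in_star[OF ch_in_car, of q]
    proof eventually_elim
      case (elim q')
      then show ?case using s[of "ch q" q'] by (simp add: s_def)
    qed
  qed
  have "s (deck 1 0 0) = s 0 + a" "s (deck 0 1 0) = s 0 + b"
    using s[of "ch 0" 0] s[of "ch 0" "deck 1 0 0"] s[of "ch 0" "deck 0 1 0"] ch_in_car[of 0] g(3)[of "ch 0" 0]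
    by (simp_all add: ac_simps)
  then show "a = 0" "b = 0" using const by (metis add_cancel_left_right)+
qed

text \<open>\<open>P\<close> marks the points where \<open>f\<close> is meaningful, as
  \<open>g q v\<close> is only when \<open>v\<close> belongs to the carrier of
  \<open>p q\<close>.\<close>

lemma deck_invariant:
  assumes "\<And>q. P q \<Longrightarrow> P (deck 1 0 q) \<and> f (deck 1 0 q) = f q"
    "\<And>q. P q \<Longrightarrow> P (deck 0 1 q) \<and> f (deck 0 1 q) = f q"
    "\<And>q m n. P (deck m n q) \<longleftrightarrow> P q" "P q"
  shows "f (deck m n q) = f q"
proof -
  have 1: "f (deck m 0 r) = f r" if "P r" for m r
  proof (induction m rule: int_induct[where k = 0])
    case (step1 i)
    have "deck (i + 1) 0 r = deck 1 0 (deck i 0 r)" by (simp add: deck_deck add.commute)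
    then show ?case using step1 assms that by metis
  next
    case (step2 i)
    have "deck i 0 r = deck 1 0 (deck (i - 1) 0 r)" by (simp add: deck_deck)
    then show ?case using step2 assms that by metis
  qed simp
  have 2: "f (deck 0 n r) = f r" if "P r" for n r
  proof (induction n rule: int_induct[where k = 0])
    case (step1 i)
    have "deck 0 (i + 1) r = deck 0 1 (deck 0 i r)" by (simp add: deck_deck add.commute)
    then show ?case using step1 assms that by metis
  next
    case (step2 i)
    have "deck 0 i r = deck 0 1 (deck 0 (i - 1) r)" by (simp add: deck_deck)
    then show ?case using step2 assms that by metis
  qed simp
  have "deck m n q = deck m 0 (deck 0 n q)" by (simp add: deck_deck)
  then show ?thesis using 1[of "deck 0 n q" m] 2[of q n] assms by metis
qed

text \<open>With trivial monodromy \<open>g\<close> descends to a function \<open>gx\<close> on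
  \<open>X\<close>, and \<open>d\<close> takes its value at the vertices. From a vertex to the
  midpoint of an edge \<open>gx\<close> does not change in the chart of that vertex; at the midpoint
  the charts of both ends differ by \<open>c\<close>.\<close>

lemma trivial_monodromy_imp_coboundary:
  assumes "has_monodromy c 0 0" and c: "c \<in> supp_fun E"
  shows "c \<in> B1"
proof -
  obtain g where g: "\<And>q v w. \<lbrakk>v \<in> car (p q); w \<in> car (p q); v \<noteq> w\<rbrakk> \<Longrightarrow> g q v + g q w = c {v, w}"
    "\<And>q v. v \<in> car (p q) \<Longrightarrow> \<forall>\<^sub>F q' in nhds q. g q' v = g q v"
    "\<And>q v. v \<in> car (p q) \<Longrightarrow> g (deck 1 0 q) v = g q v + 0 \<and> g (deck 0 1 q) v = g q v + 0"
    using assms(1) unfolding has_monodromy_def by blast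
  define gx where "gx x v = g (SOME q. p q = x) v" for x v
  have gx: "gx (p q) v = g q v" if v: "v \<in> car (p q)" for q v
  proof -
    have "p (SOME r. p r = p q) = p q" by (rule someI[of _ q]) simp
    then obtain m n where "(SOME r. p r = p q) = deck m n q" using p_eq_iff by metis
    moreover have "g (deck m n q) v = g q v"
      by (rule deck_invariant[where P = "\<lambda>q. v \<in> car (p q)" and f = "\<lambda>q. g q v"]) (use g v in auto)
    ultimately show ?thesis by (simp add: gx_def)
  qed
  define d where "d v = (if v \<in> V then gx v v else 0)" for v
  have end_value: "gx (midpoint v w) v = d v" if vw: "{v, w} \<in> K" for v w
  proof -
    let ?m = "midpoint v w" and ?S = "closed_segment v (midpoint v w)"
    have v: "v \<in> V" using vw by (auto simp: V_eq)
    have vh: "v \<in> convex hull {v, w}" by (simp add: hull_inc)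
    note m = edge_midpoint[OF vw]
    have SX: "?S \<subseteq> convex hull {v, w}" using vh m(3) by (intro closed_segment_subset) auto
    have car_S: "v \<in> car y" if "y \<in> ?S" for y
      using car_closed_segment[of v v ?m "{v, w}" y] car_vertex[OF v] m vw vh that by auto
    have "gx v v = gx ?m v"
    proof (rule connected_local_const[where A = ?S and f = "\<lambda>x. gx x v"])
      show "\<forall>a\<in>?S. \<forall>\<^sub>F b in at a within ?S. gx a v = gx b v"
      proof
        fix a assume a: "a \<in> ?S"
        then have "a \<in> X" using SX in_X vw by blast
        then obtain q where q: "p q = a" by (rule lift)
        then have "\<forall>\<^sub>F q' in nhds q. g q' v = g q v" using g(2) car_S[OF a] by simp
        then obtain N where N: "open N" "q \<in> N" "\<And>q'. q' \<in> N \<Longrightarrow> g q' v = g q v"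
          unfolding eventually_nhds by blast
        \<comment> \<open>Openness of \<open>p\<close> carries local constancy from the plane down
          to \<open>X\<close>.\<close>
        obtain O' where O': "open O'" "p ` N = X \<inter> O'"
          using open_p[OF N(1)] unfolding openin_open by blast
        have "gx a v = gx b v" if b: "b \<in> O'" "b \<in> ?S" for b
        proof -
          have "b \<in> p ` N" using O' b SX in_X vw by blast
          then obtain q' where "q' \<in> N" "b = p q'" by blast
          then show ?thesis using gx[of v q] gx[of v q'] car_S[OF a] car_S[OF b(2)] N(3) q by simp
        qed
        moreover have "a \<in> O'" using N q O' by blast
        ultimately show "\<forall>\<^sub>F b in at a within ?S. gx a v = gx b v"
          using O'(1) unfolding eventually_at_topological by blast
      qed
    qed auto
    then show ?thesis using v by (simp add: d_def)
  qed
  have "c e = d0 d e" for e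
  proof (cases "e \<in> E")
    case True
    then obtain v w where vw: "v \<noteq> w" "e = {v, w}" "{v, w} \<in> K" using E_iff by blast
    note m = edge_midpoint[OF vw(3)]
    obtain q where q: "p q = midpoint v w" using lift[OF m(1)] .
    have "gx (midpoint v w) w = d w"
      using end_value[of w v] vw by (simp add: insert_commute midpoint_sym)
    then have "c {v, w} = d v + d w"
      using g(1)[of v q w] gx[of v q] gx[of w q] end_value[OF vw(3)] m(2) q vw(1) by simp
    then show ?thesis using d0_edge vw by simp
  next
    case False
    then show ?thesis using c by (simp add: d0_def supp_fun_def)
  qed
  then have "c = d0 d" by blast
  then show ?thesis unfolding B1_def by (auto simp: d_def supp_fun_def intro!: imageI)
qed

text \<open>Compactness gives the number on the unit square; deck transformations are isometries
  that leave \<open>p\<close> unchanged and spread it over the plane.\<close>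

lemma star_Lebesgue_number:
  obtains \<delta> where "\<delta> > 0" "\<And>q. \<exists>u. \<forall>q'. dist q q' < \<delta> \<longrightarrow> u \<in> car (p q')"
proof -
  have "unit_square \<subseteq> \<Union>(range (\<lambda>u. {q. u \<in> car (p q)}))" using ch_in_car by blast
  then obtain \<delta> where \<delta>: "\<delta> > 0"
    "\<And>q. q \<in> unit_square \<Longrightarrow> \<exists>N\<in>range (\<lambda>u. {q. u \<in> car (p q)}). ball q \<delta> \<subseteq> N"
    using Heine_Borel_lemma[OF compact_unit_square, of "range (\<lambda>u. {q. u \<in> car (p q)})"] open_vimage_star
    by (metis (no_types, lifting) rangeE)
  have "\<exists>u. \<forall>q'. dist q q' < \<delta> \<longrightarrow> u \<in> car (p q')" for q
  proof -
    obtain m n where mn: "deck m n q \<in> unit_square" using deck_into_unit_square by blast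
    then obtain u where u: "ball (deck m n q) \<delta> \<subseteq> {q. u \<in> car (p q)}"
      using \<delta>(2) by blast
    have "u \<in> car (p q')" if "dist q q' < \<delta>" for q'
    proof -
      have "deck m n q' \<in> ball (deck m n q) \<delta>" using that by (simp add: dist_deck)
      then have "u \<in> car (p (deck m n q'))" using u by blast
      then show ?thesis by simp
    qed
    then show ?thesis by blast
  qed
  then show ?thesis using that \<delta> by blast
qed

text \<open>\<tau> is the transition between the charts chosen at two nearby points, through any
  vertex \<open>u\<close> common to both carriers; the cocycle condition makes it independent of
  \<open>u\<close>. As a local cocycle on the starlike plane it has a primitive \<open>G\<close>,
  which compensates the jumps of \<open>ch\<close> in \<open>g\<close>.\<close>

lemma cocycle_has_monodromy:
  assumes c: "c \<in> Z1"
  shows "\<exists>a b. has_monodromy c a b"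
proof -
  \<comment> \<open>Degenerate edges get the value 0, so that the triangle identity also covers
    repeated vertices.\<close>
  define cc where "cc v w = (if v = w then 0 else c {v, w})" for v w
  have cc_sym: "cc v w = cc w v" for v w by (simp add: cc_def insert_commute)
  have cc_self: "cc v v = 0" for v by (simp add: cc_def)
  have cc: "cc u v + cc v w = cc u w" if C: "C \<in> K" "u \<in> C" "v \<in> C" "w \<in> C" for C u v w
  proof (cases "u = v \<or> v = w \<or> u = w")
    case True
    then show ?thesis by (auto simp: cc_def insert_commute)
  next
    case False
    then have t: "{u, v, w} \<in> F" using C subset_in_K[of C "{u, v, w}"] by (auto simp: F_def)
    have "d1 c {u, v, w} = 0" using c by (simp add: Z1_def)
    then have "c {u, v} + c {v, w} + c {u, w} = 0" using d1_triangle[OF t] by simp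
    then have "c {u, v} + c {v, w} = c {u, w}" by (simp only: bit_add_eq_0_iff)
    then show ?thesis using False by (simp add: cc_def)
  qed
  have cc_car: "cc u v + cc v w = cc u w" if "u \<in> car (p q)" "v \<in> car (p q)" "w \<in> car (p q)" for q u v w
    using cc[OF car_in_K_hull(1)[OF p_in_X] that] .
  define \<tau> where "\<tau> q r = (let u = (SOME u. u \<in> car (p q) \<and> u \<in> car (p r)) in cc (ch q) u + cc u (ch r))" for q r
  have \<tau>: "\<tau> q r = cc (ch q) u + cc u (ch r)" if u: "u \<in> car (p q)" "u \<in> car (p r)" for q r u
  proof -
    define u' where "u' = (SOME u. u \<in> car (p q) \<and> u \<in> car (p r))"
    have u': "u' \<in> car (p q) \<and> u' \<in> car (p r)"
      unfolding u'_def using u by (metis (mono_tags, lifting) someI)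
    have "cc (ch q) u + cc u u' = cc (ch q) u'" using u u' ch_in_car by (intro cc_car[of _ q]) auto
    moreover have "cc u u' + cc u' (ch r) = cc u (ch r)" using u u' ch_in_car by (intro cc_car[of _ r]) auto
    moreover have "\<tau> q r = cc (ch q) u' + cc u' (ch r)" by (simp add: \<tau>_def u'_def Let_def)
    ultimately show ?thesis by (metis add.assoc)
  qed
  obtain \<delta> where \<delta>: "\<delta> > 0" "\<And>q. \<exists>u. \<forall>q'. dist q q' < \<delta> \<longrightarrow> u \<in> car (p q')"
    using star_Lebesgue_number by blast
  have "\<exists>G. \<forall>x\<in>UNIV. \<forall>y\<in>UNIV. dist x y < \<delta> / 2 \<longrightarrow> G y - G x = \<tau> x y"
  proof (rule local_cocycle_trivial[where z = 0])
    fix x y w :: "real \<times> real"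
    assume xyw: "dist x y < \<delta>" "dist y w < \<delta>" "dist x w < \<delta>"
    obtain u where u: "\<And>q'. dist x q' < \<delta> \<Longrightarrow> u \<in> car (p q')"
      using \<delta>(2) by blast
    then have "u \<in> car (p x)" "u \<in> car (p y)" "u \<in> car (p w)" using xyw \<delta>(1) by auto
    then show "\<tau> x y + \<tau> y w = \<tau> x w"
      by (simp add: \<tau> cc_sym[of "ch y" u] add.assoc)
  qed (use \<delta> in auto)
  then obtain G where G: "\<And>x y. dist x y < \<delta> / 2 \<Longrightarrow> G y + G x = \<tau> x y" by auto
  define g where "g q v = G q + cc (ch q) v" for q v
  have g1: "g q v + g q w = cc v w" if "v \<in> car (p q)" "w \<in> car (p q)" for q v w
  proof -
    have "g q v + g q w = cc v (ch q) + cc (ch q) w"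
      by (simp add: g_def cc_sym[of v "ch q"] ac_simps)
    then show ?thesis using cc_car[of v q "ch q" w] that ch_in_car by simp
  qed
  have g2: "\<forall>\<^sub>F q' in nhds q. g q' v = g q v" if v: "v \<in> car (p q)" for q v
  proof -
    have "\<forall>\<^sub>F q' in nhds q. dist q' q < \<delta> / 2"
      using \<delta>(1) unfolding eventually_nhds_metric by (intro exI[of _ "\<delta> / 2"]) auto
    with eventually_in_star[OF v] show ?thesis
    proof eventually_elim
      case (elim q')
      then have "G q' + G q = cc (ch q) v + cc v (ch q')"
        using G[of q q'] \<tau>[OF v, of q'] by (simp add: dist_commute)
      then show ?case unfolding g_def
        using cc_sym[of v "ch q'"] by (metis add.commute add.left_commute bit_add_self(2))
    qed
  qed
  have g3: "\<exists>a. \<forall>q. \<forall>v\<in>car (p q). g (deck m n q) v = g q v + a" for m n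
  proof -
    \<comment> \<open>The change of \<open>g\<close> under the deck transformation. It does not
      depend on the vertex, because both values of \<open>g\<close> vary with the vertex by the same
      \<open>cc\<close>.\<close>
    define s where "s q = g (deck m n q) (ch q) + g q (ch q)" for q
    have s: "s q = g (deck m n q) v + g q v" if v: "v \<in> car (p q)" for q v
    proof -
      have "g (deck m n q) (ch q) + g (deck m n q) v = g q (ch q) + g q v"
        using g1[of "ch q" q v] g1[of "ch q" "deck m n q" v] v ch_in_car[of q] by simp
      then show ?thesis unfolding s_def by (metis add.commute add.left_commute bit_add_self(2))
    qed
    have "s q = s 0" for q
    proof (rule constant_if_locally_constant)
      fix q
      have v: "ch q \<in> car (p (deck m n q))" using ch_in_car[of q] by simp
      have "\<forall>\<^sub>F q' in nhds q. g (deck m n q') (ch q) = g (deck m n q) (ch q)"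
        using g2[OF v] unfolding eventually_nhds_metric by (metis dist_deck)
      with g2[OF ch_in_car] eventually_in_star[OF ch_in_car, of q]
      show "\<forall>\<^sub>F q' in nhds q. s q' = s q"
      proof eventually_elim
        case (elim q')
        then show ?case using s[of "ch q" q'] by (simp add: s_def)
      qed
    qed
    then have "g (deck m n q) v = g q v + s 0" if "v \<in> car (p q)" for q v
      using s[OF that] by (metis add.commute add.left_commute bit_add_self(2))
    then show ?thesis by blast
  qed
  obtain a where "\<And>q v. v \<in> car (p q) \<Longrightarrow> g (deck 1 0 q) v = g q v + a"
    using g3 by metis
  moreover obtain b where "\<And>q v. v \<in> car (p q) \<Longrightarrow> g (deck 0 1 q) v = g q v + b"
    using g3 by metis
  ultimately have "has_monodromy c a b"
    unfolding has_monodromy_def using g1 g2 by (intro exI[of _ g]) (auto simp: cc_def)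
  then show ?thesis by blast
qed

text \<open>If \<open>q\<close> is the image under \<open>deck m n\<close> of a point of the
  half-open unit square, this is \<open>a * m + b * n\<close> modulo two. The sign of
  \<open>m\<close> is lost modulo two, so every choice of \<open>a\<close> and \<open>b\<close>
  gives a homomorphism of the deck group.\<close>

definition \<psi> :: "bit \<Rightarrow> bit \<Rightarrow> real \<times> real \<Rightarrow> bit" where
  "\<psi> a b q = a * of_int \<lfloor>par \<lfloor>snd q\<rfloor> * fst q\<rfloor> + b * of_int \<lfloor>snd q\<rfloor>"

lemma \<psi>_deck: "\<psi> a b (deck m n q) = \<psi> a b q + (a * of_int m + b * of_int n)"
proof -
  obtain x y where q: "q = (x, y)" by force
  have "par (\<lfloor>y\<rfloor> + n) * (par n * x + of_int m) = par \<lfloor>y\<rfloor> * x + of_int (if even (\<lfloor>y\<rfloor> + n) then m else - m)"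
    by (auto simp: par_def)
  then have "\<lfloor>par (\<lfloor>y\<rfloor> + n) * (par n * x + of_int m)\<rfloor> = \<lfloor>par \<lfloor>y\<rfloor> * x\<rfloor> + (if even (\<lfloor>y\<rfloor> + n) then m else - m)"
    by (simp only: floor_add_int)
  moreover have "of_int (if even (\<lfloor>y\<rfloor> + n) then m else - m) = (of_int m :: bit)" by simp
  ultimately have "of_int \<lfloor>par (\<lfloor>y\<rfloor> + n) * (par n * x + of_int m)\<rfloor> = (of_int \<lfloor>par \<lfloor>y\<rfloor> * x\<rfloor> + of_int m :: bit)"
    by (metis of_int_add)
  then show ?thesis
    by (simp add: \<psi>_def q deck_def distrib_left ac_simps)
qed

text \<open>Close lifts of the same two points are carried to each other by one common deck
  transformation, whose contribution cancels in the sum.\<close>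

lemma \<psi>_close:
  assumes "p q = p r" "p q' = p r'" "dist q q' < 1/4" "dist r r' < 1/4"
  shows "\<psi> a b q + \<psi> a b q' = \<psi> a b r + \<psi> a b r'"
proof -
  obtain m n where r: "r = deck m n q" using assms p_eq_iff by blast
  obtain m' n' where r': "r' = deck m' n' q'" using assms p_eq_iff by blast
  have "dist (deck m n q) (deck m' n' q) \<le> dist r r' + dist (deck m' n' q') (deck m' n' q)"
    unfolding r r' by (rule dist_triangle)
  also have "\<dots> < 1" using assms by (simp add: dist_deck dist_commute)
  finally have "m = m'" "n = n'" by (rule deck_eq_if_close)+
  then show ?thesis by (simp add: r r' \<psi>_deck ac_simps)
qed

text \<open>Radius 1/8 puts any two points of the sheet less than 1/4 apart, the distance at which
  comparing \<psi> at two lifts is independent of the lifts.\<close>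

lemma sheet_Lebesgue_number:
  obtains \<delta> where "\<delta> > 0" "\<And>x. x \<in> X \<Longrightarrow> \<exists>q. ball x \<delta> \<inter> X \<subseteq> p ` ball q (1/8)"
proof -
  have "\<exists>O'. open O' \<and> p ` ball q (1/8) = X \<inter> O'" for q
    using open_p[of "ball q (1/8)"] unfolding openin_open by blast
  then obtain O' where O': "\<And>q. open (O' q)" "\<And>q. p ` ball q (1/8) = X \<inter> O' q" by metis
  have "X \<subseteq> \<Union>(range O')"
  proof
    fix x assume "x \<in> X"
    then obtain q where "p q = x" by (rule lift)
    then have "x \<in> p ` ball q (1/8)" by force
    then show "x \<in> \<Union>(range O')" using O'(2) by blast
  qed
  then obtain \<delta> where \<delta>: "\<delta> > 0" "\<And>x. x \<in> X \<Longrightarrow> \<exists>N\<in>range O'. ball x \<delta> \<subseteq> N"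
    using Heine_Borel_lemma[OF compact_X, of "range O'"] O'(1) by (metis rangeE)
  have "\<exists>q. ball x \<delta> \<inter> X \<subseteq> p ` ball q (1/8)" if x: "x \<in> X" for x
    using \<delta>(2)[OF x] O'(2) by blast
  then show ?thesis using that \<delta>(1) by blast
qed

text \<open>A homomorphism from the deck group to \<open>bit\<close> is realised by the local cocycle \<open>\<tau>\<close> on \<open>X\<close> that compares
  \<open>\<psi>\<close> at nearby lifts; on each closed star it has a primitive \<open>\<sigma> v\<close>, and these differ by constants
  on the intersections of open stars.\<close>

lemma monodromy_surjective: "\<exists>c\<in>Z1. has_monodromy c a b"
proof -
  define \<tau> where "\<tau> x y = (let (q, r) = (SOME (q, r). p q = x \<and> p r = y \<and> dist q r < 1/4) in \<psi> a b r + \<psi> a b q)" for x y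
  have \<tau>: "\<tau> (p q) (p r) = \<psi> a b r + \<psi> a b q" if qr: "dist q r < 1/4" for q r
  proof -
    obtain q' r' where e: "(SOME (q', r'). p q' = p q \<and> p r' = p r \<and> dist q' r' < 1/4) = (q', r')"
      by (rule prod.exhaust)
    have "case (SOME (q', r'). p q' = p q \<and> p r' = p r \<and> dist q' r' < 1/4) of (q', r') \<Rightarrow>
        p q' = p q \<and> p r' = p r \<and> dist q' r' < 1/4"
      by (rule someI[of _ "(q, r)"]) (use qr in simp)
    then have "p q' = p q" "p r' = p r" "dist q' r' < 1/4" unfolding e by auto
    then have "\<psi> a b r' + \<psi> a b q' = \<psi> a b r + \<psi> a b q"
      using \<psi>_close[of r' r q' q] qr by (simp add: dist_commute)
    then show ?thesis unfolding \<tau>_def e by simp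
  qed
  obtain \<delta> where \<delta>: "\<delta> > 0" "\<And>x. x \<in> X \<Longrightarrow> \<exists>q. ball x \<delta> \<inter> X \<subseteq> p ` ball q (1/8)"
    using sheet_Lebesgue_number by blast
  \<comment> \<open>The closed star, in general not convex but starlike about
    \<open>v\<close>.\<close>
  define St where "St v = (\<Union>C\<in>{C \<in> K. v \<in> C}. convex hull C)" for v
  have StX: "St v \<subseteq> X" for v by (auto simp: St_def X_def)
  have in_St: "x \<in> St v" if "x \<in> X" "v \<in> car x" for x v
    using car_in_K_hull[OF that(1)] that(2) by (auto simp: St_def)
  have "\<exists>G. \<forall>x\<in>St v. \<forall>y\<in>St v. dist x y < \<delta> / 2 \<longrightarrow> G y - G x = \<tau> x y" for v
  proof (rule local_cocycle_trivial[where z = v])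
    fix x assume "x \<in> St v"
    then obtain C where C: "C \<in> K" "v \<in> C" "x \<in> convex hull C" by (auto simp: St_def)
    then have "closed_segment v x \<subseteq> convex hull C"
      by (intro closed_segment_subset) (auto intro: hull_inc)
    then show "closed_segment v x \<subseteq> St v" using C by (auto simp: St_def)
  next
    fix x y w assume xyw: "x \<in> St v" "y \<in> St v" "w \<in> St v" "dist x y < \<delta>" "dist y w < \<delta>" "dist x w < \<delta>"
    then have "x \<in> X" "y \<in> X" "w \<in> X" using StX by auto
    obtain q where q: "ball x \<delta> \<inter> X \<subseteq> p ` ball q (1/8)"
      using \<delta>(2)[OF \<open>x \<in> X\<close>] by blast
    have "x \<in> p ` ball q (1/8)" "y \<in> p ` ball q (1/8)" "w \<in> p ` ball q (1/8)"
      using q \<open>x \<in> X\<close> \<open>y \<in> X\<close> \<open>w \<in> X\<close> xyw \<delta>(1) by (auto simp: subset_iff)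
    then obtain qx qy qw where l: "x = p qx" "y = p qy" "w = p qw"
      "dist q qx < 1/8" "dist q qy < 1/8" "dist q qw < 1/8" by auto
    have "dist qx qy < 1/4" "dist qy qw < 1/4" "dist qx qw < 1/4"
      using l(4-6) dist_triangle3[of qx qy q] dist_triangle3[of qy qw q] dist_triangle3[of qx qw q] by linarith+
    then show "\<tau> x y + \<tau> y w = \<tau> x w" unfolding l by (simp add: \<tau> ac_simps)
  qed (rule \<delta>(1))
  then obtain \<sigma> where \<sigma>: "\<And>v x y. \<lbrakk>x \<in> St v; y \<in> St v; dist x y < \<delta> / 2\<rbrakk> \<Longrightarrow> \<sigma> v y + \<sigma> v x = \<tau> x y"
    by (simp only: minus_bit_def) metis
  define mid where "mid e = (SOME x. x \<in> X \<and> car x = e)" for e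
  have mid: "mid e \<in> X \<and> car (mid e) = e" if "e \<in> K" "e \<noteq> {}" for e
    unfolding mid_def by (rule someI_ex) (metis face_interior_point that)
  \<comment> \<open>The constant by which the primitives at the two ends of \<open>e\<close> differ
    is sampled at one point with carrier \<open>e\<close>.\<close>
  define c where "c e = (if e \<in> E then \<Sum>v\<in>e. \<sigma> v (mid e) else 0)" for e
  define g where "g q v = \<sigma> v (p q) + \<psi> a b q" for q v
  have g1: "g q v + g q w = c {v, w}" if vw: "v \<in> car (p q)" "w \<in> car (p q)" "v \<noteq> w" for q v w
  proof -
    let ?y = "mid {v, w}" and ?x = "p q"
    have K: "{v, w} \<in> K" by (rule car_edge[OF vw(1,2)])
    have y: "?y \<in> X" "car ?y = {v, w}" using mid[OF K] by auto
    have h: "?x \<in> convex hull (car ?x)" "car ?x \<in> K" using car_in_K_hull[OF p_in_X] by auto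
    have yh: "?y \<in> convex hull (car ?x)"
      using in_hull_iff[OF y(1) h(2)] y(2) vw by simp
    \<comment> \<open>The segment from the sample point to \<open>?x\<close> stays in both open
      stars, where the two primitives vary by the same \<tau>.\<close>
    have seg: "z \<in> X \<and> v \<in> car z \<and> w \<in> car z" if z: "z \<in> closed_segment ?y ?x" for z
    proof -
      have "z \<in> convex hull (car ?x)"
        using z yh h(1) by (meson closed_segment_subset convex_convex_hull subsetD)
      then show ?thesis
        using car_closed_segment[OF _ _ h(2) yh h(1) z, of v] car_closed_segment[OF _ _ h(2) yh h(1) z, of w]
          in_X[OF h(2)] y(2) vw by auto
    qed
    have "\<sigma> v ?y + \<sigma> w ?y = \<sigma> v ?x + \<sigma> w ?x"
    proof (rule connected_local_const[where A = "closed_segment ?y ?x" and f = "\<lambda>z. \<sigma> v z + \<sigma> w z"])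
      show "\<forall>z\<in>closed_segment ?y ?x. \<forall>\<^sub>F z' in at z within closed_segment ?y ?x. \<sigma> v z + \<sigma> w z = \<sigma> v z' + \<sigma> w z'"
      proof
        fix z assume z: "z \<in> closed_segment ?y ?x"
        have "\<forall>\<^sub>F z' in at z within closed_segment ?y ?x. z' \<in> closed_segment ?y ?x \<and> dist z' z < \<delta> / 2"
          using \<delta>(1) unfolding eventually_at by (intro exI[of _ "\<delta> / 2"]) auto
        then show "\<forall>\<^sub>F z' in at z within closed_segment ?y ?x. \<sigma> v z + \<sigma> w z = \<sigma> v z' + \<sigma> w z'"
        proof eventually_elim
          case (elim z')
          then have "\<sigma> v z' + \<sigma> v z = \<tau> z z'" "\<sigma> w z' + \<sigma> w z = \<tau> z z'"
            using seg[OF z] seg[of z'] in_St by (auto intro!: \<sigma> simp: dist_commute)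
          then have "\<sigma> v z' + \<sigma> v z = \<sigma> w z' + \<sigma> w z" by simp
          then show ?case by (metis add.commute add.left_commute bit_add_self(2))
        qed
      qed
    qed auto
    moreover have "c {v, w} = \<sigma> v ?y + \<sigma> w ?y" using K vw(3) by (simp add: c_def E_def)
    ultimately show ?thesis by (simp add: g_def ac_simps)
  qed
  have g2: "\<forall>\<^sub>F q' in nhds q. g q' v = g q v" if v: "v \<in> car (p q)" for q v
  proof -
    have "\<forall>\<^sub>F q' in nhds q. dist q' q < 1/4"
      unfolding eventually_nhds_metric by (intro exI[of _ "1/4"]) auto
    moreover have "\<forall>\<^sub>F q' in nhds q. p q' \<in> ball (p q) (\<delta> / 2)"
    proof -
      have "open (p -` ball (p q) (\<delta> / 2))"
        using cont_p open_ball by (metis continuous_on_open_vimage open_UNIV Int_UNIV_right)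
      then show ?thesis unfolding eventually_nhds using \<delta>(1) by (intro exI[of _ "p -` ball (p q) (\<delta> / 2)"]) auto
    qed
    ultimately show ?thesis using eventually_in_star[OF v]
    proof eventually_elim
      case (elim q')
      have "\<sigma> v (p q') + \<sigma> v (p q) = \<tau> (p q) (p q')"
        using elim in_St v by (intro \<sigma>) auto
      also have "\<dots> = \<psi> a b q' + \<psi> a b q" using elim by (intro \<tau>) (simp add: dist_commute)
      finally show ?case unfolding g_def by (metis add.commute add.left_commute bit_add_self(2))
    qed
  qed
  have g3: "g (deck 1 0 q) v = g q v + a" "g (deck 0 1 q) v = g q v + b" for q v
    by (simp_all add: g_def \<psi>_deck add.assoc)
  have "has_monodromy c a b"
    unfolding has_monodromy_def using g1 g2 g3 by (intro exI[of _ g]) auto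
  moreover have "d1 c t = 0" for t
  proof (cases "t \<in> F")
    case True
    then have t: "t \<in> K" "card t = 3" by (auto simp: F_def)
    then obtain u v w where uvw: "t = {u, v, w}" "u \<noteq> v" "v \<noteq> w" "u \<noteq> w"
      by (metis card_3_iff)
    obtain x where x: "x \<in> X" "car x = t" using face_interior_point[OF t(1)] uvw by blast
    obtain q where q: "p q = x" using lift[OF x(1)] .
    have "c {u, v} = g q u + g q v" "c {v, w} = g q v + g q w" "c {u, w} = g q u + g q w"
      using g1[of u q v] g1[of v q w] g1[of u q w] q x uvw by simp_all
    then show ?thesis using d1_triangle[of u v w c] True uvw by (simp add: ac_simps)
  qed (simp add: d1_def)
  then have "c \<in> Z1" by (auto simp: Z1_def c_def supp_fun_def)
  ultimately show ?thesis by blast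
qed

section \<open>The four classes of cocycles and the final count\<close>

lemma has_monodromy_unique:
  assumes "has_monodromy c a b" "has_monodromy c a' b'"
  shows "a = a' \<and> b = b'"
proof -
  have "c + c = d0 0" by (rule ext) (simp add: d0_def)
  then have "has_monodromy (d0 0) (a + a') (b + b')" using has_monodromy_add[OF assms] by simp
  then have "a + a' = 0" "b + b' = 0" by (rule has_monodromy_coboundary)+
  then show ?thesis by (simp add: bit_add_eq_0_iff)
qed

lemma card_Z1: "card Z1 = card B1 * 4"
proof -
  define \<Phi> where "\<Phi> c = (SOME (a, b). has_monodromy c a b)" for c
  have \<Phi>: "\<Phi> c = (a, b)" if "has_monodromy c a b" for c a b
  proof -
    have "case \<Phi> c of (a, b) \<Rightarrow> has_monodromy c a b"
      unfolding \<Phi>_def by (rule someI[of _ "(a, b)"]) (use that in simp)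
    then show ?thesis using has_monodromy_unique[OF that] by (auto split: prod.splits)
  qed
  have Z_add: "x + y \<in> Z1" if "x \<in> Z1" "y \<in> Z1" for x y
    using that by (simp add: Z1_def supp_fun_add d1_add)
  have "card Z1 = card {c \<in> Z1. \<Phi> c = 0} * card (\<Phi> ` Z1)"
  proof (rule card_eq_card_kernel_times_card_image)
    show "finite Z1" using finite_E by (simp add: Z1_def)
    show "0 \<in> Z1" by (auto simp: Z1_def d1_def)
    fix x y assume xy: "x \<in> Z1" "y \<in> Z1"
    then show "x - y \<in> Z1" using Z_add by simp
    obtain a b where 1: "has_monodromy x a b" using cocycle_has_monodromy xy by blast
    obtain a' b' where 2: "has_monodromy y a' b'" using cocycle_has_monodromy xy by blast
    show "\<Phi> (x - y) = \<Phi> x - \<Phi> y"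
      using \<Phi>[OF has_monodromy_add[OF 1 2]] \<Phi>[OF 1] \<Phi>[OF 2] by simp
  qed
  moreover have "{c \<in> Z1. \<Phi> c = 0} = B1"
  proof (intro equalityI subsetI)
    fix c assume c: "c \<in> {c \<in> Z1. \<Phi> c = 0}"
    then obtain a b where ab: "has_monodromy c a b" using cocycle_has_monodromy by blast
    then have "a = 0" "b = 0" using \<Phi>[OF ab] c by (auto simp: zero_prod_def)
    then show "c \<in> B1" using trivial_monodromy_imp_coboundary ab c by (auto simp: Z1_def)
  next
    fix c assume c: "c \<in> B1"
    then have "c \<in> Z1" using B1_subset_Z1 by blast
    then obtain a b where ab: "has_monodromy c a b" using cocycle_has_monodromy by blast
    obtain d where "c = d0 d" using c by (auto simp: B1_def)
    then have "a = 0" "b = 0" using ab has_monodromy_coboundary by auto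
    then show "c \<in> {c \<in> Z1. \<Phi> c = 0}"
      using \<Phi>[OF ab] \<open>c \<in> Z1\<close> by (simp add: zero_prod_def)
  qed
  moreover have "\<Phi> ` Z1 = UNIV \<times> UNIV"
  proof -
    have "(a, b) \<in> \<Phi> ` Z1" for a b
      using monodromy_surjective[of a b] \<Phi>[of _ a b] by (metis image_eqI)
    then show ?thesis by auto
  qed
  then have "card (\<Phi> ` Z1) = 4" by (simp only: card_cartesian_product card_UNIV_bit)
  ultimately show ?thesis by simp
qed

theorem Euler_characteristic: "card V + card F = card E"
proof -
  have "(2::nat) ^ (card E + 1) = card Z1 * card (d1 ` supp_fun E) * 2"
    by (simp add: card_E_Z1)
  also have "\<dots> = 2 * card B1 * (card (d1 ` supp_fun E) * 2) * 2" by (simp add: card_Z1)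
  also have "\<dots> = 2 ^ (card V + card F + 1)"
    by (simp add: power_add flip: card_V_B1 card_F_image)
  finally show ?thesis by simp
qed

end

section \<open>The Klein bottle as a quotient of the plane\<close>

lemma continuous_deck: "continuous_on S (deck m n)"
  unfolding deck_def by (intro continuous_intros)

lemma deck_orbit_sym: "q' = deck m n q \<Longrightarrow> \<exists>m n. q = deck m n q'"
  using deck_inverse by metis

text \<open>Two points of the square are at most 1 apart in each coordinate, so only few
  \<open>m\<close> and \<open>n\<close> occur, and unless both are 0 the points lie on sides or at
  corners. The corners need the side gluings combined: all four are one class.\<close>

lemma deck_glue: "((x, y), deck m n (x, y)) \<in> klein_rel"
  if "(x, y) \<in> unit_square" "deck m n (x, y) \<in> unit_square" for x y m n
proof -
  have sym: "(s, r) \<in> klein_rel" if "(r, s) \<in> klein_rel" for r s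
    using equiv_klein_rel that by (meson equivE symD)
  have trans: "(r, u) \<in> klein_rel" if "(r, s) \<in> klein_rel" "(s, u) \<in> klein_rel" for r s u
    using that unfolding klein_rel_def by (rule rtrancl_trans)
  have glue: "(r, s) \<in> klein_rel" if "(r, s) \<in> klein_glue" for r s
    using that unfolding klein_rel_def by auto
  have vert: "((0, t), (1, t)) \<in> klein_rel" if "0 \<le> t" "t \<le> 1" for t
    using that by (intro glue) (auto simp: klein_glue_def)
  have hor: "((t, 0), (1 - t, 1)) \<in> klein_rel" if "0 \<le> t" "t \<le> 1" for t
    using that by (intro glue) (auto simp: klein_glue_def)
  have corner0: "((0, 0), (0, 1)) \<in> klein_rel"
    using trans[of "(0, 0)" "(1, 1)" "(0, 1)"] hor[of 0] sym[OF vert[of 1]] by simp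
  have corner1: "((1, 0), (1, 1)) \<in> klein_rel"
    using trans[of "(1, 0)" "(0, 1)" "(1, 1)"] hor[of 1] vert[of 1] by simp
  \<comment> \<open>The map is the reflection of \<open>x\<close> to \<open>of_int m - x\<close>:
    \<open>m = 1\<close> is the horizontal gluing, while 0 and 2 are possible only at a
    corner.\<close>
  have up: "((x, 0), deck m 1 (x, 0)) \<in> klein_rel" if u: "0 \<le> x" "x \<le> 1" "deck m 1 (x, 0) \<in> unit_square" for x m
  proof -
    have m: "0 \<le> of_int m - x" "of_int m - x \<le> 1"
      using u by (auto simp: deck_def par_def unit_square_def)
    then have "(0::real) \<le> of_int m" "of_int m \<le> (2::real)" using u by linarith+
    then have "0 \<le> m" "m \<le> 2" by linarith+
    then have "m = 0 \<or> m = 1 \<or> m = 2" by presburger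
    then consider "m = 0" "x = 0" | "m = 1" | "m = 2" "x = 1" using m u by auto
    then show ?thesis
      using corner0 corner1 hor[of x] u(1,2) by cases (simp_all add: deck_def par_def)
  qed
  have xy: "0 \<le> x" "x \<le> 1" "0 \<le> y" "y \<le> 1" using that by (auto simp: unit_square_def)
  have ny: "0 \<le> y + of_int n" "y + of_int n \<le> 1" using that by (auto simp: deck_def unit_square_def)
  then have "(-1::real) \<le> of_int n" "of_int n \<le> (1::real)" using xy by linarith+
  then have "-1 \<le> n" "n \<le> 1" by linarith+
  then have "n = -1 \<or> n = 0 \<or> n = 1" by presburger
  then consider "n = -1" "y = 1" | "n = 0" | "n = 1" "y = 0" using ny xy by auto
  then show ?thesis
  proof cases
    case 1
    \<comment> \<open>For odd shifts \<open>deck m 1\<close> undoes \<open>deck m (- 1)\<close> with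
      the same \<open>m\<close>, so the step down is a step up reversed.\<close>
    define r where "r = deck m n (x, y)"
    have r: "r = (of_int m - x, 0)" by (simp add: r_def deck_def par_def 1)
    have return: "deck m 1 r = (x, y)" by (simp add: r deck_def par_def 1)
    have "0 \<le> of_int m - x" "of_int m - x \<le> 1"
      using that(2) r unfolding r_def[symmetric] by (auto simp: unit_square_def)
    then have "(r, deck m 1 r) \<in> klein_rel"
      unfolding r using return that(1) unfolding r by (intro up) auto
    then show ?thesis unfolding return by (metis sym r_def)
  next
    case 2
    have m: "0 \<le> x + of_int m" "x + of_int m \<le> 1"
      using that 2 by (auto simp: deck_def par_def unit_square_def)
    then have "(-1::real) \<le> of_int m" "of_int m \<le> (1::real)" using xy by linarith+
    then have "-1 \<le> m" "m \<le> 1" by linarith+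
    then have "m = -1 \<or> m = 0 \<or> m = 1" by presburger
    then consider "m = -1" "x = 1" | "m = 0" | "m = 1" "x = 0" using m xy by auto
    then show ?thesis
    proof cases
      case 1 then show ?thesis using sym[OF vert[of y]] xy 2 by (simp add: deck_def par_def)
    next
      case b: 2 then show ?thesis using 2 by (simp add: klein_rel_def)
    next
      case 3 then show ?thesis using vert[of y] xy 2 by (simp add: deck_def par_def)
    qed
  next
    case 3
    then show ?thesis using up[of x m] xy that by simp
  qed
qed

lemma klein_rel_imp_deck:
  assumes "(r, s) \<in> klein_rel"
  shows "\<exists>m n. s = deck m n r"
  using assms unfolding klein_rel_def
proof (induction rule: rtrancl_induct)
  case base
  then show ?case by (intro exI[of _ 0]) simp
next
  case (step s u)
  then obtain m n where s: "s = deck m n r" by blast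
  have glue: "\<exists>m n. b = deck m n a" if ab: "(a, b) \<in> klein_glue" for a b
  proof -
    consider t where "a = (0, t)" "b = (1, t)" | t where "a = (t, 0)" "b = (1 - t, 1)"
      using ab by (auto simp: klein_glue_def)
    then show ?thesis
    proof cases
      case 1 then show ?thesis by (intro exI[of _ 1] exI[of _ 0]) (simp add: deck_def par_def)
    next
      case 2 then show ?thesis by (intro exI[of _ 1] exI[of _ 1]) (simp add: deck_def par_def)
    qed
  qed
  have "\<exists>m n. u = deck m n s" using step(2) glue deck_orbit_sym by (metis UnE converseD)
  then show ?case using s deck_deck by metis
qed

text \<open>The universal covering map, with orbits cut down to the square so that the values are
  literally the classes of \<open>klein_rel\<close> there.\<close>

definition klein_proj :: "real \<times> real \<Rightarrow> (real \<times> real) set" where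
  "klein_proj q = {s \<in> unit_square. \<exists>m n. s = deck m n q}"

lemma klein_proj_eq_iff: "klein_proj q = klein_proj q' \<longleftrightarrow> (\<exists>m n. q' = deck m n q)"
proof
  assume eq: "klein_proj q = klein_proj q'"
  obtain m n where "deck m n q \<in> unit_square" using deck_into_unit_square by blast
  then have "deck m n q \<in> klein_proj q" by (auto simp: klein_proj_def)
  then have "deck m n q \<in> klein_proj q'" unfolding eq .
  then obtain m' n' where "deck m n q = deck m' n' q'" by (auto simp: klein_proj_def)
  then show "\<exists>m n. q' = deck m n q" using deck_inverse deck_deck by metis
next
  assume "\<exists>m n. q' = deck m n q"
  then obtain m n where q': "q' = deck m n q" by blast
  have "(\<exists>m n. s = deck m n q) \<longleftrightarrow> (\<exists>m n. s = deck m n q')" for s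
    using deck_deck deck_inverse[of n m q] unfolding q' by metis
  then show "klein_proj q = klein_proj q'" by (simp add: klein_proj_def)
qed

lemma klein_proj_square: "s \<in> unit_square \<Longrightarrow> klein_proj s = klein_rel `` {s}"
  using klein_rel_imp_deck klein_rel_unit_square deck_glue[of "fst s" "snd s"]
  by (auto simp: klein_proj_def)

lemma range_klein_proj: "range klein_proj = topspace klein_bottle"
proof -
  have "range klein_proj = klein_proj ` unit_square"
  proof -
    have "klein_proj q \<in> klein_proj ` unit_square" for q
      using deck_into_unit_square[of q] klein_proj_eq_iff[of q] by blast
    then show ?thesis by auto
  qed
  also have "\<dots> = unit_square // klein_rel"
    by (auto simp: quotient_def klein_proj_square)
  also have "\<dots> = topspace klein_bottle"
    by (simp add: klein_bottle_def topspace_quotient_topology)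
  finally show ?thesis .
qed

lemma openin_klein_bottle:
  "openin klein_bottle W \<longleftrightarrow> W \<subseteq> topspace klein_bottle \<and> openin (top_of_set unit_square) (unit_square \<inter> klein_proj -` W)"
proof -
  have "{x \<in> unit_square. klein_rel `` {x} \<in> W} = unit_square \<inter> klein_proj -` W"
    using klein_proj_square by auto
  then show ?thesis
    unfolding klein_bottle_def openin_quotient_topology topspace_quotient_topology by simp
qed

text \<open>The saturation of \<open>U\<close> is the union of its preimages under all deck
  transformations.\<close>

lemma open_klein_proj:
  assumes "open U"
  shows "openin klein_bottle (klein_proj ` U)"
proof -
  have "klein_proj -` klein_proj ` U = (\<Union>m n. deck m n -` U)"
  proof (intro equalityI subsetI)
    fix x assume "x \<in> klein_proj -` klein_proj ` U"
    then obtain u where "u \<in> U" "klein_proj x = klein_proj u" by auto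
    then show "x \<in> (\<Union>m n. deck m n -` U)" using klein_proj_eq_iff[of x u] by auto
  next
    fix x assume "x \<in> (\<Union>m n. deck m n -` U)"
    then obtain m n where "deck m n x \<in> U" by auto
    moreover have "klein_proj x = klein_proj (deck m n x)" using klein_proj_eq_iff by blast
    ultimately show "x \<in> klein_proj -` klein_proj ` U" by auto
  qed
  moreover have "open (\<Union>m n. deck m n -` U)"
    using assms by (intro open_UN ballI open_vimage continuous_deck) auto
  ultimately have "openin (top_of_set unit_square) (unit_square \<inter> klein_proj -` klein_proj ` U)"
    by (simp add: openin_open_Int)
  then show ?thesis using range_klein_proj by (auto simp: openin_klein_bottle)
qed

text \<open>At the sides of the square, openness relative to it says nothing about points outside.
  Instead the closed complement \<open>A\<close> is transported: finitely many of its translates can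
  reach the unit ball around \<open>q0\<close>, and removing them leaves a neighbourhood.\<close>

lemma open_vimage_klein_proj:
  assumes W: "openin klein_bottle W"
  shows "open (klein_proj -` W)"
proof (subst open_subopen, intro ballI)
  fix q0 assume q0: "q0 \<in> klein_proj -` W"
  define A where "A = unit_square - klein_proj -` W"
  have "openin (top_of_set unit_square) (unit_square \<inter> klein_proj -` W)"
    using W by (simp add: openin_klein_bottle)
  then have "closedin (top_of_set unit_square) A"
    unfolding A_def closedin_def by (auto simp: Diff_Diff_Int)
  then have "closed A"
    using compact_unit_square compact_imp_closed closedin_closed_trans by blast
  \<comment> \<open>A shift that takes a point within distance 1 of \<open>q0\<close> into the
    square moves each coordinate by an integer within this bound.\<close>
  define N where "N = \<lceil>\<bar>fst q0\<bar> + \<bar>snd q0\<bar> + 3\<rceil>"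
  define D where "D = (\<Union>m\<in>{-N..N}. \<Union>n\<in>{-N..N}. deck m n -` A)"
  have "closed D" unfolding D_def
    using \<open>closed A\<close> by (intro closed_UN ballI closed_vimage continuous_deck) auto
  have inv: "klein_proj (deck m n q) = klein_proj q" for m n q
    using klein_proj_eq_iff by metis
  have "q0 \<notin> D" using q0 by (auto simp: D_def A_def inv)
  moreover have "q \<in> klein_proj -` W" if q: "q \<in> ball q0 1" "q \<notin> D" for q
  proof -
    obtain m n where mn: "deck m n q \<in> unit_square" using deck_into_unit_square by blast
    have "\<bar>fst q0 - fst q\<bar> < 1" "\<bar>snd q0 - snd q\<bar> < 1"
      using q(1) dist_fst_le[of q0 q] dist_snd_le[of q0 q] by (auto simp: dist_real_def)
    moreover have "0 \<le> par n * fst q + of_int m" "par n * fst q + of_int m \<le> 1"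
      "0 \<le> snd q + of_int n" "snd q + of_int n \<le> 1"
      using mn by (auto simp: deck_def unit_square_def)
    moreover have "\<bar>par n * fst q\<bar> = \<bar>fst q\<bar>" by (simp add: par_def)
    ultimately have "\<bar>real_of_int m\<bar> \<le> \<bar>fst q0\<bar> + \<bar>snd q0\<bar> + 3" "\<bar>real_of_int n\<bar> \<le> \<bar>fst q0\<bar> + \<bar>snd q0\<bar> + 3"
      by linarith+
    then have "m \<in> {-N..N}" "n \<in> {-N..N}" unfolding N_def by (simp_all; linarith)+
    then have "deck m n q \<notin> A" using q(2) by (auto simp: D_def)
    then show ?thesis using mn by (auto simp: A_def inv)
  qed
  ultimately show "\<exists>T. open T \<and> q0 \<in> T \<and> T \<subseteq> klein_proj -` W"
    using \<open>closed D\<close> by (intro exI[of _ "ball q0 1 - D"]) (auto intro: open_Diff)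
qed

lemma continuous_klein_proj: "continuous_map euclidean klein_bottle klein_proj"
  unfolding continuous_map_def
proof (intro conjI allI impI)
  show "klein_proj \<in> topspace euclidean \<rightarrow> topspace klein_bottle"
    using range_klein_proj by auto
  show "openin euclidean {x \<in> topspace euclidean. klein_proj x \<in> W}" if "openin klein_bottle W" for W
    using open_vimage_klein_proj[OF that] by (simp add: vimage_def)
qed

section \<open>Triangulations\<close>

definition vertex_sets :: "'a::euclidean_space set set \<Rightarrow> 'a set set" where
  "vertex_sets T = {C. \<not> affine_dependent C \<and> convex hull C \<in> T}"

text \<open>The vertices are recovered from the simplex as its extreme points.\<close>

lemma convex_hull_affine_independent_inject:
  fixes C D :: "'a::euclidean_space set"
  assumes "\<not> affine_dependent C" "\<not> affine_dependent D" "convex hull C = convex hull D"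
  shows "C = D"
  using assms extreme_point_of_convex_hull_affine_independent by (metis subsetI subset_antisym)

lemma inj_on_hull_vertex_sets: "inj_on ((hull) convex) (vertex_sets T)"
  using convex_hull_affine_independent_inject by (auto simp: inj_on_def vertex_sets_def)

lemma simplex_vertex_set:
  assumes "simplicial_complex T" "S \<in> T"
  obtains C where "C \<in> vertex_sets T" "S = convex hull C"
proof -
  obtain n where "n simplex S" using assms by (auto simp: simplicial_complex_def)
  then obtain C where "\<not> affine_dependent C" "S = convex hull C" by (auto simp: simplex_def)
  then show ?thesis using that assms by (auto simp: vertex_sets_def)
qed

lemma plane_simplicial_complex_vertex_sets:
  assumes "two_dim_simplicial_complex T"
  shows "plane_simplicial_complex (vertex_sets T)"
proof
  have T: "simplicial_complex T" and dim: "\<And>S. S \<in> T \<Longrightarrow> aff_dim S \<le> 2"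
    using assms by (auto simp: two_dim_simplicial_complex_def)
  have "finite T" using T by (simp add: simplicial_complex_def)
  moreover have "(hull) convex ` vertex_sets T \<subseteq> T" by (auto simp: vertex_sets_def)
  ultimately show "finite (vertex_sets T)"
    using inj_on_finite[OF inj_on_hull_vertex_sets] by blast
  fix C assume C: "C \<in> vertex_sets T"
  then show ind: "\<not> affine_dependent C" by (simp add: vertex_sets_def)
  have face: "A face_of convex hull C \<longleftrightarrow> (\<exists>c\<subseteq>C. A = convex hull c)" for A
    by (rule face_of_convex_hull_affine_independent[OF ind])
  show "D \<in> vertex_sets T" if "D \<subseteq> C" for D
  proof -
    have "convex hull D face_of convex hull C" using face that by blast
    moreover have "convex hull C \<in> T" using C by (simp add: vertex_sets_def)
    ultimately have "convex hull D \<in> T" using T unfolding simplicial_complex_def by blast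
    then show ?thesis using ind that affine_dependent_subset by (auto simp: vertex_sets_def)
  qed
  show "card C \<le> 3"
  proof -
    have "aff_dim C \<le> 2" using dim[of "convex hull C"] C
      by (simp add: vertex_sets_def aff_dim_convex_hull)
    then show ?thesis using aff_dim_affine_independent[OF ind] by linarith
  qed
  fix D assume D: "D \<in> vertex_sets T"
  have indD: "\<not> affine_dependent D" using D by (simp add: vertex_sets_def)
  have CD: "convex hull C \<in> T" "convex hull D \<in> T" using C D by (auto simp: vertex_sets_def)
  have "convex hull C \<inter> convex hull D face_of convex hull C" "convex hull D \<inter> convex hull C face_of convex hull D"
    using T CD unfolding simplicial_complex_def by blast+
  \<comment> \<open>The common face has vertices \<open>c\<close> as a face of one simplex and
    \<open>d\<close> as a face of the other; vertex sets being unique, these coincide and lie in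
    \<open>C \<inter> D\<close>.\<close>
  then obtain c d where c: "c \<subseteq> C" "convex hull C \<inter> convex hull D = convex hull c"
    and d: "d \<subseteq> D" "convex hull D \<inter> convex hull C = convex hull d"
    using face face_of_convex_hull_affine_independent[OF indD] by metis
  have "\<not> affine_dependent c" "\<not> affine_dependent d"
    using c(1) d(1) ind indD affine_dependent_subset by blast+
  moreover have "convex hull c = convex hull d" using c(2) d(2) by (simp add: Int_commute)
  ultimately have "c = d" by (rule convex_hull_affine_independent_inject)
  then have "convex hull c \<subseteq> convex hull (C \<inter> D)" using c d by (intro hull_mono) auto
  moreover have "convex hull (C \<inter> D) \<subseteq> convex hull C \<inter> convex hull D"
    by (simp add: hull_mono)
  ultimately show "convex hull C \<inter> convex hull D = convex hull (C \<inter> D)" using c by simp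
qed

lemma num_simplices_eq_card_vertex_sets:
  "num_simplices (int k) T = card {C \<in> vertex_sets T. card C = Suc k}"
proof -
  have "{S \<in> T. int k simplex S} = (hull) convex ` {C \<in> vertex_sets T. card C = Suc k}"
    by (auto simp: simplex_def vertex_sets_def)
  then show ?thesis unfolding num_simplices_def
    using card_image[OF inj_on_subset[OF inj_on_hull_vertex_sets[of T], of "{C \<in> vertex_sets T. card C = Suc k}"]]
    by auto
qed

theorem mainTheorem5:
  fixes T :: "'a::euclidean_space set set" and h :: "'a \<Rightarrow> (real \<times> real) set"
  assumes "is_triangulation_of T h klein_bottle"
  shows "int (num_simplices 0 T) - int (num_simplices 1 T) + int (num_simplices 2 T) = 0"
proof -
  have T: "two_dim_simplicial_complex T" and h: "homeomorphic_map (top_of_set (\<Union>T)) klein_bottle h"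
    using assms by (auto simp: is_triangulation_of_def)
  have sT: "simplicial_complex T" using T by (simp add: two_dim_simplicial_complex_def)
  interpret plane_simplicial_complex "vertex_sets T"
    by (rule plane_simplicial_complex_vertex_sets[OF T])
  have X: "X = \<Union>T"
  proof
    show "X \<subseteq> \<Union>T" unfolding X_def by (auto simp: vertex_sets_def)
    show "\<Union>T \<subseteq> X" using simplex_vertex_set[OF sT] in_X by (metis Union_least subsetI)
  qed
  obtain k where "homeomorphic_maps (top_of_set X) klein_bottle h k"
    using h unfolding X homeomorphic_map_maps by blast
  then have k: "homeomorphic_map klein_bottle (top_of_set X) k"
    by (simp add: homeomorphic_maps_map)
  \<comment> \<open>The inverse \<open>k\<close> of the triangulating homeomorphism brings the plane
    covering to the realization.\<close>
  define p where "p = k \<circ> klein_proj"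
  interpret klein_cover "vertex_sets T" p
  proof
    have "continuous_map euclidean (top_of_set X) p"
      unfolding p_def using continuous_klein_proj homeomorphic_imp_continuous_map[OF k]
      by (rule continuous_map_compose)
    then show "continuous_on UNIV p" by (simp add: continuous_map_in_subtopology)
    show "openin (top_of_set X) (p ` U)" if "open U" for U
      using homeomorphic_imp_open_map[OF k] open_klein_proj[OF that]
      unfolding open_map_def p_def image_comp[symmetric] by blast
    show "range p = X"
      using homeomorphic_imp_surjective_map[OF k] range_klein_proj
      by (simp only: p_def image_comp[symmetric] topspace_euclidean_subtopology)
    show "p q = p q' \<longleftrightarrow> (\<exists>m n. q' = deck m n q)" for q q'
    proof -
      have "klein_proj q \<in> topspace klein_bottle" "klein_proj q' \<in> topspace klein_bottle"
        using range_klein_proj by auto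
      then have "p q = p q' \<longleftrightarrow> klein_proj q = klein_proj q'"
        using homeomorphic_imp_injective_map[OF k] by (auto simp: p_def inj_on_def)
      then show ?thesis by (simp add: klein_proj_eq_iff)
    qed
    show "F \<noteq> {}"
    proof -
      obtain S where S: "S \<in> T" "aff_dim S = 2" using T by (auto simp: two_dim_simplicial_complex_def)
      obtain C where C: "C \<in> vertex_sets T" "S = convex hull C" using simplex_vertex_set[OF sT S(1)] .
      have "aff_dim C = 2" using S(2) unfolding C(2) aff_dim_convex_hull .
      then have "card C = 3" using aff_dim_affine_independent[OF indep[OF C(1)]] by simp
      then show ?thesis using C by (auto simp: F_def)
    qed
  qed
  have "{C \<in> vertex_sets T. card C = 1} = (\<lambda>v. {v}) ` V"
    by (auto simp: V_def card_1_singleton_iff)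
  then have "card {C \<in> vertex_sets T. card C = 1} = card V" by (simp add: card_image)
  then have "num_simplices 0 T = card V" "num_simplices 1 T = card E" "num_simplices 2 T = card F"
    using num_simplices_eq_card_vertex_sets[of 0 T] num_simplices_eq_card_vertex_sets[of 1 T]
      num_simplices_eq_card_vertex_sets[of 2 T]
    by (simp_all add: E_def F_def numeral_2_eq_2 numeral_3_eq_3)
  then show ?thesis using Euler_characteristic by simp
qed

end
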